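(* Let $L,\alpha,K,\gamma_0>0$ with $\gamma_0\ne\sqrt{\alpha/K}$. Consider the eigenvalue problem of finding $\lambda\in\mathbb C$ and $u\not\equiv0$ on $(0,L)$ with $$Ku''''-\alpha\lambda^2u''+\lambda^2u=0,\qquad u(0)=u'(0)=u(L)=0,\qquad u''(L)+\gamma_0\lambda u'(L)=0 .$$ Its eigenvalues $\{\lambda^{\pm}_{0,n}\}$, for sufficiently large $n$ (i.e. all but finitely many eigenvalues), consist of complex conjugate pairs $\lambda^-_{0,n}=\overline{\lambda^+_{0,n}}$, $\lambda^+_{0,n}$, with asymptotic form $$\lambda^+_{0,n}=i\sqrt{\tfrac K\alpha}\;\sigma_{0,n}+O\!\left(\tfrac1n\right)\qquad\text{as } n\to\infty,$$ where $$\sigma_{0,n}=\begin{cases}\dfrac{i}{2L}\ln\left|\dfrac{\gamma_0\sqrt{K/\alpha}+1}{\gamma_0\sqrt{K/\alpha}-1}\right|+\dfrac{n\pi}{L}, & \gamma_0>\sqrt{\alpha/K},\\[3mm] \dfrac{i}{2L}\ln\left|\dfrac{\gamma_0\sqrt{K/\alpha}+1}{\gamma_0\sqrt{K/\alpha}-1}\right|+\dfrac{(n+\frac12)\pi}{L}, & \gamma_0<\sqrt{\alpha/K}.\end{cases}$$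
   Context: Primes denote differentiation in $x\in(0,L)$. The eigenvalue problem is that of the Rayleigh beam $\ddot z-\alpha\ddot z''+Kz''''=0$ on $(0,L)$ with $z(0,t)=z'(0,t)=z(L,t)=0$ and boundary feedback $z''(L,t)+\gamma_0\dot z'(L,t)=0$, obtained by inserting $z=e^{\lambda t}u(x)$. *)

theory Defs
  imports "HOL-Analysis.Analysis" "HOL-Library.Landau_Symbols"
begin

text \<open>
  Eigenfunctions are classical: \<open>u\<close> is four times differentiable on the closed interval
  \<open>[0, L]\<close> (one-sided at the endpoints), with derivatives \<open>u1, u2, u3, u4\<close>. Since the equation
  is linear with constant coefficients and \<open>K > 0\<close>, every weak solution has this regularity.
  Only the values of \<open>u\<close> on \<open>[0, L]\<close> matter.
\<close>

definition rayleigh_eigenfunction ::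
  "real \<Rightarrow> real \<Rightarrow> real \<Rightarrow> real \<Rightarrow> complex \<Rightarrow> (real \<Rightarrow> complex) \<Rightarrow> bool" where
  "rayleigh_eigenfunction L \<alpha> K \<gamma>\<^sub>0 lam u \<longleftrightarrow>
     (\<exists>x\<in>{0<..<L}. u x \<noteq> 0) \<and>
     (\<exists>u1 u2 u3 u4.
        (\<forall>x\<in>{0..L}.
           (u has_vector_derivative u1 x) (at x within {0..L}) \<and>
           (u1 has_vector_derivative u2 x) (at x within {0..L}) \<and>
           (u2 has_vector_derivative u3 x) (at x within {0..L}) \<and>
           (u3 has_vector_derivative u4 x) (at x within {0..L})) \<and>
        (\<forall>x\<in>{0<..<L}.
           of_real K * u4 x - of_real \<alpha> * lam\<^sup>2 * u2 x + lam\<^sup>2 * u x = 0) \<and>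
        u 0 = 0 \<and> u1 0 = 0 \<and> u L = 0 \<and>
        u2 L + of_real \<gamma>\<^sub>0 * lam * u1 L = 0)"

definition rayleigh_eigenvalues ::
  "real \<Rightarrow> real \<Rightarrow> real \<Rightarrow> real \<Rightarrow> complex set" where
  "rayleigh_eigenvalues L \<alpha> K \<gamma>\<^sub>0 = {lam. \<exists>u. rayleigh_eigenfunction L \<alpha> K \<gamma>\<^sub>0 lam u}"

text \<open>The excluded value \<open>\<gamma>\<^sub>0 = sqrt (\<alpha> / K)\<close> falls into the second branch and carries no meaning.\<close>

definition rayleigh_sigma :: "real \<Rightarrow> real \<Rightarrow> real \<Rightarrow> real \<Rightarrow> nat \<Rightarrow> complex" where
  "rayleigh_sigma L \<alpha> K \<gamma>\<^sub>0 n =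
     \<i> / of_real (2 * L) *
       of_real (ln \<bar>(\<gamma>\<^sub>0 * sqrt (K / \<alpha>) + 1) / (\<gamma>\<^sub>0 * sqrt (K / \<alpha>) - 1)\<bar>) +
     (if \<gamma>\<^sub>0 > sqrt (\<alpha> / K)
      then of_real (real n * pi / L)
      else of_real ((real n + 1 / 2) * pi / L))"

end

theory Submission
  imports Defs "HOL-Complex_Analysis.Complex_Analysis"
begin

text \<open>
  Let \<open>s = sqrt (K / \<alpha>)\<close>. A solution of the beam equation that is clamped at \<open>0\<close> is a combination of two fundamental
  solutions, and the boundary conditions at \<open>L\<close> are two linear equations for the coefficients. So the eigenvalues are the
  zeros of a determinant (\<open>eigenvalue_iff_char\<close>). It is entire in \<open>lam\<close> and does not vanish at \<open>0\<close>; therefore every disc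
  contains only finitely many eigenvalues (\<open>finite_eigenvalues_in_disc\<close>), and only large \<open>lam\<close> need to be understood.

  For large \<open>lam\<close> the exponents of the solutions are \<open>\<plusminus> m\<close> and \<open>\<plusminus> n\<close>, where \<open>m\<close> is close to \<open>lam / s\<close> and \<open>n\<close> is close to
  \<open>1 / sqrt \<alpha>\<close>. Both \<open>lam\<close> and \<open>n\<close> are functions of \<open>m\<close>, analytic in \<open>1 / m\<close> up to a factor \<open>m\<close>, and every large \<open>lam\<close> is
  obtained from some \<open>m\<close> (\<open>beam_lambda_surj\<close>). Up to a non-zero factor the determinant is affine in \<open>cosh (m L)\<close> and
  \<open>sinh (m L)\<close>, with coefficients analytic in \<open>1 / m\<close>. Its vanishing becomes
  \<open>exp (2 L m) = a (1 / m) + b (1 / m) exp (L m)\<close>, where \<open>a\<close> and \<open>b\<close> are analytic at \<open>0\<close>,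
  \<open>a 0 = (\<gamma> s - 1) / (\<gamma> s + 1)\<close> and \<open>b 0 = 0\<close> (\<open>eigenvalue_iff_quasi_polynomial\<close>, \<open>quasi_polynomial_coeffs\<close>).

  The limiting equation \<open>exp (2 L m) = a 0\<close> has the equidistant solutions \<open>c n = (Ln (a 0) + 2 pi n \<i>) / (2 L)\<close>. For the full
  equation a logarithm and a contraction argument give, for each large \<open>n\<close>, exactly one solution within \<open>O(1 / n)\<close> of \<open>c n\<close>,
  and no other solutions of large modulus (\<open>quasi_polynomial_roots\<close>). Since \<open>lam = s m + O(1 / m)\<close>
  (\<open>beam_lambda_asymp\<close>), the eigenvalues are \<open>s c n + O(1 / n)\<close>, and \<open>c n = \<i> \<sigma> n\<close> for \<open>n \<ge> 0\<close>
  (\<open>quasi_polynomial_centre_eq_sigma\<close>). The eigenvalues in the lower half plane follow by complex conjugation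
  (\<open>eigenvalues_cnj\<close>).
\<close>

section \<open>Uniqueness for the beam equation\<close>

text \<open>
  The function \<open>exp (- m x) w x\<close> has derivative \<open>0\<close>. The equation is required in the open interval only,
  because an eigenfunction is not assumed to satisfy its differential equation at the endpoints.
\<close>

lemma first_order_ode_zero:
  fixes w :: "real \<Rightarrow> complex"
  assumes cont: "continuous_on {0..L} w"
    and deriv: "\<And>x. x \<in> {0<..<L} \<Longrightarrow> x \<in> {0..L} \<Longrightarrow> (w has_vector_derivative m * w x) (at x within {0..L})"
    and init: "w 0 = 0" and x: "x \<in> {0..L}"
  shows "w x = 0"
proof -
  define f where "f = (\<lambda>x::real. exp (- m * of_real x) * w x)"
  have "f x = 0"
  proof (rule has_derivative_zero_unique_strong_interval[of "{0, L}" 0 L f])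
    show "continuous_on {0..L} f"
      unfolding f_def by (intro continuous_intros cont)
    show "(f has_derivative (\<lambda>h. 0)) (at y within {0..L})" if "y \<in> {0..L} - {0, L}" for y
    proof -
      have "((\<lambda>z. exp (- m * z)) has_field_derivative - m * exp (- m * of_real y)) (at (of_real y))"
        by (auto intro!: derivative_eq_intros)
      then have "((\<lambda>x::real. exp (- m * of_real x)) has_vector_derivative - m * exp (- m * of_real y))
          (at y within {0..L})"
        by (rule has_vector_derivative_real_field)
      from has_vector_derivative_mult[OF this deriv[of y]] that
      have "(f has_vector_derivative 0) (at y within {0..L})"
        by (simp add: f_def algebra_simps)
      then show ?thesis by (simp add: has_vector_derivative_def)
    qed
  qed (use init x in \<open>auto simp: f_def\<close>)
  then show ?thesis by (simp add: f_def)
qed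

text \<open>
  The sequence \<open>v\<close> lists a solution of \<open>D^4 u = p D^2 u + q u\<close> (with \<open>D\<close> for differentiation) together with its derivatives, \<open>v k\<close> being
  the \<open>k\<close>-th one. The equation itself is imposed in the open interval, as in the
  eigenvalue problem.
\<close>

definition beam_jet :: "real \<Rightarrow> complex \<Rightarrow> complex \<Rightarrow> (nat \<Rightarrow> real \<Rightarrow> complex) \<Rightarrow> bool" where
  "beam_jet L p q v \<longleftrightarrow>
     (\<forall>k<3. \<forall>x\<in>{0..L}. (v k has_vector_derivative v (Suc k) x) (at x within {0..L})) \<and>
     continuous_on {0..L} (v 3) \<and>
     (\<forall>x\<in>{0<..<L}. (v 3 has_vector_derivative p * v 2 x + q * v 0 x) (at x within {0..L}))"

lemma beam_jetD:
  assumes "beam_jet L p q v"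
  shows "x \<in> {0..L} \<Longrightarrow> (v 0 has_vector_derivative v 1 x) (at x within {0..L})"
    and "x \<in> {0..L} \<Longrightarrow> (v 1 has_vector_derivative v 2 x) (at x within {0..L})"
    and "x \<in> {0..L} \<Longrightarrow> (v 2 has_vector_derivative v 3 x) (at x within {0..L})"
    and "x \<in> {0<..<L} \<Longrightarrow> (v 3 has_vector_derivative p * v 2 x + q * v 0 x) (at x within {0..L})"
    and "continuous_on {0..L} (v 3)"
  using assms by (auto simp: beam_jet_def eval_nat_numeral less_Suc_eq)

text \<open>
  The numbers \<open>m1, -m1, m2, -m2\<close> are the roots of the characteristic equation \<open>m^4 = p m^2 + q\<close>.
\<close>

lemma biquadratic_roots:
  fixes p q :: complex
  obtains m1 m2 where "p = m1\<^sup>2 + m2\<^sup>2" "q = - (m1\<^sup>2 * m2\<^sup>2)"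
proof
  define d where "d = csqrt (p\<^sup>2 + 4 * q)"
  have d2: "d\<^sup>2 = p\<^sup>2 + 4 * q" by (simp add: d_def)
  show "p = (csqrt ((p + d) / 2))\<^sup>2 + (csqrt ((p - d) / 2))\<^sup>2"
    by (simp add: field_simps)
  have "(p + d) / 2 * ((p - d) / 2) = (p\<^sup>2 - d\<^sup>2) / 4"
    by (simp add: field_simps power2_eq_square)
  then show "q = - ((csqrt ((p + d) / 2))\<^sup>2 * (csqrt ((p - d) / 2))\<^sup>2)"
    by (simp add: d2)
qed

text \<open>
  Uniqueness for the initial value problem: the equation factors as
  \<open>(D - m1) (D + m1) (D - m2) (D + m2) u = 0\<close>, so that a solution with zero initial data is stripped of
  one factor at a time by \<open>first_order_ode_zero\<close>.
\<close>

lemma beam_jet_unique_zero: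
  assumes v: "beam_jet L p q v" and init: "\<And>k. k < 4 \<Longrightarrow> v k 0 = 0"
    and x: "x \<in> {0..L}"
  shows "v 0 x = 0" "v 1 x = 0" "v 2 x = 0" "v 3 x = 0"
proof -
  note D = beam_jetD[OF v]
  obtain m1 m2 where p: "p = m1\<^sup>2 + m2\<^sup>2" and q: "q = - (m1\<^sup>2 * m2\<^sup>2)"
    by (rule biquadratic_roots)
  have i: "v 0 0 = 0" "v 1 0 = 0" "v 2 0 = 0" "v 3 0 = 0" by (auto intro: init)
  have cont: "continuous_on {0..L} (v 0)" "continuous_on {0..L} (v 1)" "continuous_on {0..L} (v 2)"
    unfolding continuous_on_eq_continuous_within
    using D(1-3) has_vector_derivative_continuous by blast+
  have w3: "v 3 x + m1 * v 2 x - m2\<^sup>2 * v 1 x - m1 * m2\<^sup>2 * v 0 x = 0" if "x \<in> {0..L}" for x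
  proof (rule first_order_ode_zero[of L "\<lambda>x. v 3 x + m1 * v 2 x - m2\<^sup>2 * v 1 x - m1 * m2\<^sup>2 * v 0 x" m1])
    show "continuous_on {0..L} (\<lambda>x. v 3 x + m1 * v 2 x - m2\<^sup>2 * v 1 x - m1 * m2\<^sup>2 * v 0 x)"
      by (intro continuous_intros cont D)
    show "((\<lambda>x. v 3 x + m1 * v 2 x - m2\<^sup>2 * v 1 x - m1 * m2\<^sup>2 * v 0 x) has_vector_derivative
       m1 * (v 3 x + m1 * v 2 x - m2\<^sup>2 * v 1 x - m1 * m2\<^sup>2 * v 0 x)) (at x within {0..L})"
      if x: "x \<in> {0<..<L}" and x': "x \<in> {0..L}" for x
      by (rule has_vector_derivative_eq_rhs,
          (rule has_vector_derivative_add has_vector_derivative_diff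
            has_vector_derivative_mult_right D(1-3)[OF x'] D(4)[OF x])+)
         (auto simp: p q algebra_simps power2_eq_square)
  qed (use that i in auto)
  have w2: "v 2 x - m2\<^sup>2 * v 0 x = 0" if "x \<in> {0..L}" for x
  proof (rule first_order_ode_zero[of L "\<lambda>x. v 2 x - m2\<^sup>2 * v 0 x" "-m1"])
    show "continuous_on {0..L} (\<lambda>x. v 2 x - m2\<^sup>2 * v 0 x)"
      by (intro continuous_intros cont D)
    show "((\<lambda>x. v 2 x - m2\<^sup>2 * v 0 x) has_vector_derivative - m1 * (v 2 x - m2\<^sup>2 * v 0 x))
       (at x within {0..L})" if x: "x \<in> {0<..<L}" and x': "x \<in> {0..L}" for x
      by (rule has_vector_derivative_eq_rhs,
          (rule has_vector_derivative_diff has_vector_derivative_mult_right D(1-3)[OF x'] D(4)[OF x])+)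
         (use x' w3[of x] in \<open>auto simp: algebra_simps\<close>)
  qed (use that i in auto)
  have w1: "v 1 x + m2 * v 0 x = 0" if "x \<in> {0..L}" for x
  proof (rule first_order_ode_zero[of L "\<lambda>x. v 1 x + m2 * v 0 x" m2])
    show "continuous_on {0..L} (\<lambda>x. v 1 x + m2 * v 0 x)"
      by (intro continuous_intros cont D)
    show "((\<lambda>x. v 1 x + m2 * v 0 x) has_vector_derivative m2 * (v 1 x + m2 * v 0 x))
       (at x within {0..L})" if x: "x \<in> {0<..<L}" and x': "x \<in> {0..L}" for x
      by (rule has_vector_derivative_eq_rhs,
          (rule has_vector_derivative_add has_vector_derivative_mult_right D(1-3)[OF x'] D(4)[OF x])+)
         (use x' w2[of x] in \<open>auto simp: algebra_simps power2_eq_square\<close>)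
  qed (use that i in auto)
  have w0: "v 0 x = 0" if "x \<in> {0..L}" for x
  proof (rule first_order_ode_zero[of L "v 0" "-m2"])
    show "(v 0 has_vector_derivative - m2 * v 0 x) (at x within {0..L})" if x: "x \<in> {0<..<L}" and x': "x \<in> {0..L}" for x
      by (rule has_vector_derivative_eq_rhs, rule D(1)[OF x'])
         (use x' w1[of x] in \<open>auto simp: algebra_simps add_eq_0_iff\<close>)
  qed (use that i cont in auto)
  show "v 0 x = 0" "v 1 x = 0" "v 2 x = 0" "v 3 x = 0"
    using w0[OF x] w1[OF x] w2[OF x] w3[OF x] by auto
qed

lemma beam_jet_combine:
  assumes "beam_jet L p q v" "beam_jet L p q w"
  shows "beam_jet L p q (\<lambda>k x. a * v k x + b * w k x)"
  unfolding beam_jet_def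
proof (intro conjI allI impI ballI)
  show "continuous_on {0..L} (\<lambda>x. a * v 3 x + b * w 3 x)"
    using assms by (auto simp: beam_jet_def intro!: continuous_intros)
  show "((\<lambda>x. a * v k x + b * w k x) has_vector_derivative a * v (Suc k) x + b * w (Suc k) x)
      (at x within {0..L})" if "k < 3" "x \<in> {0..L}" for k x
    by (intro has_vector_derivative_add has_vector_derivative_mult_right)
       (use assms that in \<open>auto simp: beam_jet_def\<close>)
  show "((\<lambda>x. a * v 3 x + b * w 3 x) has_vector_derivative
       p * (a * v 2 x + b * w 2 x) + q * (a * v 0 x + b * w 0 x)) (at x within {0..L})"
    if "x \<in> {0<..<L}" for x
    by (rule has_vector_derivative_eq_rhs,
        (rule has_vector_derivative_add has_vector_derivative_mult_right
           beam_jetD(4)[OF assms(1) that] beam_jetD(4)[OF assms(2) that])+)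
       (auto simp: algebra_simps)
qed

section \<open>Fundamental solutions\<close>

text \<open>
  The derivatives at \<open>0\<close> of the solution of \<open>D^4 u = p D^2 u + q u\<close> with \<open>u\<close>, \<open>D u\<close>, \<open>D^2 u\<close> zero
  and \<open>D^3 u = 1\<close> there.
\<close>

fun taylor_coeff :: "complex \<Rightarrow> complex \<Rightarrow> nat \<Rightarrow> complex" where
  "taylor_coeff p q 0 = 0"
| "taylor_coeff p q (Suc 0) = 0"
| "taylor_coeff p q (Suc (Suc 0)) = 0"
| "taylor_coeff p q (Suc (Suc (Suc 0))) = 1"
| "taylor_coeff p q (Suc (Suc (Suc (Suc n)))) =
     p * taylor_coeff p q (Suc (Suc n)) + q * taylor_coeff p q n"

text \<open>
  The bound is uniform for bounded \<open>p, q\<close>; this gives convergence of the Taylor series and its holomorphic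
  dependence on \<open>p\<close> and \<open>q\<close> at once.
\<close>

lemma norm_taylor_coeff_le:
  assumes "norm p \<le> B" "norm q \<le> B"
  shows "norm (taylor_coeff p q n) \<le> (1 + 2 * B) ^ n"
proof (induction n rule: less_induct)
  case (less n)
  have B: "B \<ge> 0" using assms(1) norm_ge_zero order_trans by blast
  consider "n < 4" | k where "n = Suc (Suc (Suc (Suc k)))"
  proof (cases "n < 4")
    case False
    then obtain k where "n = k + 4" by (metis add.commute le_Suc_ex not_less)
    then show ?thesis using that(2)[of k] by (simp add: eval_nat_numeral)
  qed
  then show ?case
  proof cases
    case 1
    then have "n = 0 \<or> n = 1 \<or> n = 2 \<or> n = 3" by auto
    then show ?thesis using B by (auto simp: numeral_2_eq_2 numeral_3_eq_3 one_le_mult_iff mult_ge1_I)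
  next
    case (2 k)
    let ?M = "1 + 2 * B"
    have "norm (taylor_coeff p q n) \<le> B * ?M ^ (k + 2) + B * ?M ^ k"
      unfolding 2 taylor_coeff.simps using assms less[of "Suc (Suc k)"] less[of k] B 2
      by (intro norm_triangle_mono) (auto simp: norm_mult intro!: mult_mono)
    also have "\<dots> \<le> B * ?M ^ (k + 2) + B * ?M ^ (k + 2)"
      using B by (intro add_mono mult_left_mono power_increasing) auto
    also have "\<dots> = (2 * B) * ?M ^ (k + 2)" by simp
    also have "\<dots> \<le> ?M ^ 2 * ?M ^ (k + 2)"
      using B by (intro mult_right_mono) (auto simp: power2_eq_square algebra_simps)
    also have "\<dots> = ?M ^ n" by (simp add: 2 flip: power_add)
    finally show ?thesis .
  qed
qed

text \<open>
  This is the \<open>k\<close>-th derivative of the solution whose Taylor coefficients were given above. Since \<open>k = 1\<close>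
  gives the initial data \<open>(0, 0, 1, 0)\<close>, the cases \<open>k = 0\<close> and \<open>k = 1\<close> span the solutions that are clamped
  at \<open>0\<close>. Representing them by a power series rather than by exponentials makes them entire in the
  spectral parameter, with no exception where characteristic roots coincide.
\<close>

definition fund_sol :: "nat \<Rightarrow> complex \<Rightarrow> complex \<Rightarrow> complex \<Rightarrow> complex" where
  "fund_sol k p q z = (\<Sum>n. taylor_coeff p q (n + k) / fact n * z ^ n)"

lemma norm_fund_sol_term_le:
  assumes "norm p \<le> B" "norm q \<le> B"
  shows "norm (taylor_coeff p q (n + k) / fact n * z ^ n)
           \<le> (1 + 2 * B) ^ k * (((1 + 2 * B) * norm z) ^ n / fact n)"
proof -
  have "norm (taylor_coeff p q (n + k) / fact n * z ^ n)
      = norm (taylor_coeff p q (n + k)) * (norm z ^ n / fact n)"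
    by (simp add: norm_mult norm_divide norm_power)
  also have "\<dots> \<le> (1 + 2 * B) ^ (n + k) * (norm z ^ n / fact n)"
    by (intro mult_right_mono norm_taylor_coeff_le assms) auto
  finally show ?thesis by (simp add: power_add power_mult_distrib mult_ac)
qed

lemma summable_exp_bound: "summable (\<lambda>n. M * ((c::real) ^ n / fact n))"
  using summable_exp[of c] by (intro summable_mult) (simp add: field_simps)

lemma summable_fund_sol: "summable (\<lambda>n. taylor_coeff p q (n + k) / fact n * z ^ n)"
proof (rule summable_comparison_test'[OF summable_exp_bound])
  show "norm (taylor_coeff p q (n + k) / fact n * z ^ n)
     \<le> (1 + 2 * max (norm p) (norm q)) ^ k * (((1 + 2 * max (norm p) (norm q)) * norm z) ^ n / fact n)" for n
    by (rule norm_fund_sol_term_le) auto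
qed

lemma fund_sol_deriv: "(fund_sol k p q has_field_derivative fund_sol (Suc k) p q z) (at z)"
proof -
  have "diffs (\<lambda>n. taylor_coeff p q (n + k) / fact n) = (\<lambda>n. taylor_coeff p q (n + Suc k) / fact n)"
  proof
    fix n show "diffs (\<lambda>n. taylor_coeff p q (n + k) / fact n) n = taylor_coeff p q (n + Suc k) / fact n"
      using of_nat_neq_0[of n, where 'a=complex]
      by (simp add: diffs_def field_simps del: of_nat_Suc)
  qed
  then show ?thesis
    using termdiffs_strong_converges_everywhere[of "\<lambda>n. taylor_coeff p q (n + k) / fact n" z] summable_fund_sol
    unfolding fund_sol_def by simp
qed

lemma fund_sol_at_0: "fund_sol k p q 0 = taylor_coeff p q k"
  unfolding fund_sol_def by (subst powser_zero) simp

lemma fund_sol_ode: "fund_sol (k + 4) p q z = p * fund_sol (k + 2) p q z + q * fund_sol k p q z"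
proof -
  have "p * fund_sol (k + 2) p q z + q * fund_sol k p q z
      = (\<Sum>n. p * (taylor_coeff p q (n + (k + 2)) / fact n * z ^ n)
             + q * (taylor_coeff p q (n + k) / fact n * z ^ n))"
    unfolding fund_sol_def suminf_mult[OF summable_fund_sol, symmetric]
    by (rule suminf_add[OF summable_mult[OF summable_fund_sol] summable_mult[OF summable_fund_sol]])
  also have "\<dots> = fund_sol (k + 4) p q z"
    unfolding fund_sol_def by (rule suminf_cong) (simp add: eval_nat_numeral field_simps)
  finally show ?thesis by simp
qed

lemma fund_sol_jet: "beam_jet L p q (\<lambda>k x. fund_sol (k + j) p q (of_real x))"
  unfolding beam_jet_def
proof (intro conjI allI impI ballI)
  have d: "((\<lambda>x. fund_sol i p q (of_real x)) has_vector_derivative fund_sol (Suc i) p q (of_real x))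
      (at x within {0..L})" for i x
    by (rule has_vector_derivative_real_field) (rule fund_sol_deriv)
  show "((\<lambda>x. fund_sol (k + j) p q (of_real x)) has_vector_derivative fund_sol (Suc k + j) p q (of_real x))
      (at x within {0..L})" for k x
    using d[of "k + j"] by simp
  show "continuous_on {0..L} (\<lambda>x. fund_sol (3 + j) p q (of_real x))"
    unfolding continuous_on_eq_continuous_within
    using d has_vector_derivative_continuous by blast
  show "((\<lambda>x. fund_sol (3 + j) p q (of_real x)) has_vector_derivative
      p * fund_sol (2 + j) p q (of_real x) + q * fund_sol (0 + j) p q (of_real x)) (at x within {0..L})" for x
    using d[of "3 + j" x] fund_sol_ode[of j p q "of_real x"] by (simp add: add_ac)
qed

lemma taylor_coeff_holomorphic:
  assumes "p holomorphic_on S" "q holomorphic_on S"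
  shows "(\<lambda>lam. taylor_coeff (p lam) (q lam) n) holomorphic_on S"
proof (induction n rule: less_induct)
  case (less n)
  show ?case
  proof (cases "n < 4")
    case True
    then have "n = 0 \<or> n = 1 \<or> n = 2 \<or> n = 3" by auto
    then show ?thesis by (auto simp: eval_nat_numeral)
  next
    case False
    then obtain k where "n = k + 4" by (metis add.commute le_Suc_ex not_less)
    then show ?thesis using less[of "k + 2"] less[of k] assms
      by (auto simp: eval_nat_numeral intro!: holomorphic_intros)
  qed
qed

lemma fund_sol_holomorphic:
  assumes "p holomorphic_on UNIV" "q holomorphic_on UNIV"
  shows "(\<lambda>lam. fund_sol k (p lam) (q lam) z) holomorphic_on UNIV"
proof (rule holomorphic_uniform_sequence)
  show "(\<lambda>lam. \<Sum>n<N. taylor_coeff (p lam) (q lam) (n + k) / fact n * z ^ n) holomorphic_on UNIV" for N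
    by (intro holomorphic_intros taylor_coeff_holomorphic assms) auto
  show "\<exists>d>0. cball lam d \<subseteq> UNIV \<and>
      uniform_limit (cball lam d) (\<lambda>N lam. \<Sum>n<N. taylor_coeff (p lam) (q lam) (n + k) / fact n * z ^ n)
        (\<lambda>lam. fund_sol k (p lam) (q lam) z) sequentially" for lam
  proof -
    have "bounded (p ` cball lam 1 \<union> q ` cball lam 1)"
      using assms by (intro compact_imp_bounded compact_Un compact_continuous_image
          holomorphic_on_imp_continuous_on) (auto intro: holomorphic_on_subset)
    then obtain B where B: "\<And>w. w \<in> cball lam 1 \<Longrightarrow> norm (p w) \<le> B \<and> norm (q w) \<le> B"
      unfolding bounded_iff by blast
    show ?thesis
      unfolding fund_sol_def
      by (intro exI[of _ 1] conjI Weierstrass_m_test[OF norm_fund_sol_term_le summable_exp_bound])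
         (use B in auto)
  qed
qed auto

text \<open>
  The numbers \<open>m1, -m1, m2, -m2\<close> give four geometric solutions of the recursion for the Taylor
  coefficients; the combination \<open>G\<close> below has the right first four values, and summing the series replaces
  powers by exponentials.
\<close>

lemma fund_sol_closed_form:
  assumes "m1 \<noteq> 0" "m2 \<noteq> 0" "m1\<^sup>2 \<noteq> m2\<^sup>2"
  shows "fund_sol k (m1\<^sup>2 + m2\<^sup>2) (- (m1\<^sup>2 * m2\<^sup>2)) z =
    ((m1 ^ k * exp (m1 * z) - (- m1) ^ k * exp (- m1 * z)) / (2 * m1)
     - (m2 ^ k * exp (m2 * z) - (- m2) ^ k * exp (- m2 * z)) / (2 * m2)) / (m1\<^sup>2 - m2\<^sup>2)"
proof -
  define G where "G = (\<lambda>f::complex \<Rightarrow> complex.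
    (f m1 - f (- m1)) / (2 * m1 * (m1\<^sup>2 - m2\<^sup>2)) - (f m2 - f (- m2)) / (2 * m2 * (m1\<^sup>2 - m2\<^sup>2)))"
  have G_lin: "G (\<lambda>m. a * f m + b * g m) = a * G f + b * G g" for a b f g
    by (simp add: G_def diff_divide_distrib add_divide_distrib ring_distribs)
  have nz: "m1\<^sup>2 - m2\<^sup>2 \<noteq> 0" using assms by simp
  have coeff: "taylor_coeff (m1\<^sup>2 + m2\<^sup>2) (- (m1\<^sup>2 * m2\<^sup>2)) n = G (\<lambda>m. m ^ n)" for n
  proof (induction n rule: less_induct)
    case (less n)
    show ?case
    proof (cases "n < 4")
      case True
      then have "n = 0 \<or> n = 1 \<or> n = 2 \<or> n = 3" by auto
      then show ?thesis using assms nz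
        by (auto simp: eval_nat_numeral G_def simp flip: diff_divide_distrib)
    next
      case False
      then obtain k where n: "n = k + 4" by (metis add.commute le_Suc_ex not_less)
      have "taylor_coeff (m1\<^sup>2 + m2\<^sup>2) (- (m1\<^sup>2 * m2\<^sup>2)) n
         = (m1\<^sup>2 + m2\<^sup>2) * G (\<lambda>m. m ^ (k + 2)) + (- (m1\<^sup>2 * m2\<^sup>2)) * G (\<lambda>m. m ^ k)"
        using less[of "k + 2"] less[of k] by (simp add: n eval_nat_numeral)
      also have "\<dots> = G (\<lambda>m. (m1\<^sup>2 + m2\<^sup>2) * m ^ (k + 2) + (- (m1\<^sup>2 * m2\<^sup>2)) * m ^ k)"
        by (rule G_lin[symmetric])
      also have "\<dots> = G (\<lambda>m. m ^ n)"
      proof -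
        have "(m1\<^sup>2 + m2\<^sup>2) * m ^ (k + 2) + (- (m1\<^sup>2 * m2\<^sup>2)) * m ^ k = m ^ n"
          if "m\<^sup>2 = m1\<^sup>2 \<or> m\<^sup>2 = m2\<^sup>2" for m
        proof -
          have "m ^ n = m\<^sup>2 * m\<^sup>2 * m ^ k" "m ^ (k + 2) = m\<^sup>2 * m ^ k"
            by (simp_all add: n power_add eval_nat_numeral)
          moreover have "(a + b) * (s * r) + (- (a * b)) * r = s * s * r"
            if "s = a \<or> s = b" for a b s r :: complex
            using that by (auto simp: algebra_simps)
          ultimately show ?thesis using that by metis
        qed
        from this[of m1] this[of "- m1"] this[of m2] this[of "- m2"] show ?thesis
          by (simp only: G_def power2_minus simp_thms)
      qed
      finally show ?thesis .
    qed
  qed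
  have e: "(\<lambda>n. m ^ (n + k) / fact n * z ^ n) sums (m ^ k * exp (m * z))" for m :: complex
    using sums_mult[OF exp_converges[of "m * z"], of "m ^ k"]
    by (simp add: scaleR_conv_of_real power_add power_mult_distrib field_simps)
  have "(\<lambda>n. G (\<lambda>m. m ^ (n + k) / fact n * z ^ n)) sums G (\<lambda>m. m ^ k * exp (m * z))"
    unfolding G_def by (intro sums_divide sums_diff e)
  moreover have "G (\<lambda>m. m ^ (n + k) / fact n * z ^ n)
      = taylor_coeff (m1\<^sup>2 + m2\<^sup>2) (- (m1\<^sup>2 * m2\<^sup>2)) (n + k) / fact n * z ^ n" for n
    unfolding coeff using G_lin[of "z ^ n / fact n" "\<lambda>m. m ^ (n + k)" 0 "\<lambda>_. 0"]
    by (simp add: mult_ac)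
  ultimately have "fund_sol k (m1\<^sup>2 + m2\<^sup>2) (- (m1\<^sup>2 * m2\<^sup>2)) z = G (\<lambda>m. m ^ k * exp (m * z))"
    by (simp add: fund_sol_def sums_iff)
  then show ?thesis by (simp add: G_def diff_divide_distrib)
qed

section \<open>The characteristic determinant\<close>

text \<open>
  A solution vanishing in the open interval has vanishing derivatives there, and by continuity also at the
  left endpoint. Hence non-zero initial data at \<open>0\<close> do give a non-trivial eigenfunction.
\<close>

lemma beam_jet_zero_at_0:
  assumes v: "beam_jet L p q v" and L: "L > 0"
    and zero: "\<And>x. x \<in> {0<..<L} \<Longrightarrow> v 0 x = 0" and "k < 4"
  shows "v k 0 = 0"
proof -
  have interior: "\<forall>x\<in>{0<..<L}. v k x = 0" if "k < 4" for k
    using that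
  proof (induction k)
    case (Suc k)
    show ?case
    proof
      fix x assume x: "x \<in> {0<..<L}"
      then have "(v k has_vector_derivative v (Suc k) x) (at x within {0..L})"
        using v Suc.prems by (auto simp: beam_jet_def)
      then have "(v k has_vector_derivative v (Suc k) x) (at x)"
        using x by (simp add: at_within_Icc_at)
      moreover have "(v k has_vector_derivative 0) (at x)"
        using Suc x by (intro has_vector_derivative_transform_within_open[OF has_vector_derivative_const[of 0]])
          (auto intro: open_greaterThanLessThan)
      ultimately show "v (Suc k) x = 0" by (rule vector_derivative_unique_at)
    qed
  qed (use zero in auto)
  have "continuous_on {0..L} (v k)"
  proof (cases "k = 3")
    case False
    then show ?thesis using v \<open>k < 4\<close>
      unfolding continuous_on_eq_continuous_within
    proof (intro ballI)
      fix x assume "x \<in> {0..L}"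
      with v \<open>k < 4\<close> False have "(v k has_vector_derivative v (Suc k) x) (at x within {0..L})"
        by (simp add: beam_jet_def)
      then show "continuous (at x within {0..L}) (v k)" by (rule has_vector_derivative_continuous)
    qed
  qed (use v in \<open>simp add: beam_jet_def\<close>)
  then show ?thesis
    using continuous_constant_on_closure[of "{0<..<L}" "v k" 0 0] interior[OF \<open>k < 4\<close>] L by auto
qed

text \<open>
  The characteristic determinant: the general solution clamped at \<open>0\<close> is \<open>a g 1 + b g 0\<close>, and the two boundary
  conditions at \<open>L\<close> are linear equations for \<open>(a, b)\<close> with this determinant.
\<close>

definition rayleigh_char :: "real \<Rightarrow> real \<Rightarrow> real \<Rightarrow> real \<Rightarrow> complex \<Rightarrow> complex" where
  "rayleigh_char L \<alpha> K \<gamma> lam =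
     (let g = (\<lambda>k. fund_sol k (of_real \<alpha> * lam\<^sup>2 / of_real K) (- lam\<^sup>2 / of_real K) (of_real L))
      in g 1 * (g 2 + of_real \<gamma> * lam * g 1) - g 0 * (g 3 + of_real \<gamma> * lam * g 2))"

lemma singular_2x2_iff:
  fixes a b c d :: "'a::field"
  shows "a * d - b * c = 0 \<longleftrightarrow> (\<exists>x y. (x \<noteq> 0 \<or> y \<noteq> 0) \<and> x * a + y * b = 0 \<and> x * c + y * d = 0)"
proof
  assume det: "a * d - b * c = 0"
  consider "a \<noteq> 0 \<or> b \<noteq> 0" | "a = 0" "b = 0" "c \<noteq> 0 \<or> d \<noteq> 0" | "a = 0" "b = 0" "c = 0" "d = 0"
    by blast
  then show "\<exists>x y. (x \<noteq> 0 \<or> y \<noteq> 0) \<and> x * a + y * b = 0 \<and> x * c + y * d = 0"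
  proof cases
    case 1
    then show ?thesis using det by (intro exI[of _ b] exI[of _ "-a"]) (auto simp: algebra_simps)
  next
    case 2
    then show ?thesis by (intro exI[of _ d] exI[of _ "-c"]) (auto simp: algebra_simps)
  next
    case 3
    then show ?thesis by (intro exI[of _ 1]) auto
  qed
next
  assume "\<exists>x y. (x \<noteq> 0 \<or> y \<noteq> 0) \<and> x * a + y * b = 0 \<and> x * c + y * d = 0"
  then obtain x y where xy: "x \<noteq> 0 \<or> y \<noteq> 0" "x * a + y * b = 0" "x * c + y * d = 0" by blast
  have "x * (a * d - b * c) = d * (x * a + y * b) - b * (x * c + y * d)"
       "y * (a * d - b * c) = a * (x * c + y * d) - c * (x * a + y * b)"
    by (simp_all add: algebra_simps)
  then show "a * d - b * c = 0" using xy by auto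
qed

lemma rayleigh_eigenvalueI:
  assumes "x0 \<in> {0<..<L}" "u x0 \<noteq> 0"
    and "\<And>x. x \<in> {0..L} \<Longrightarrow> (u has_vector_derivative u1 x) (at x within {0..L})"
    and "\<And>x. x \<in> {0..L} \<Longrightarrow> (u1 has_vector_derivative u2 x) (at x within {0..L})"
    and "\<And>x. x \<in> {0..L} \<Longrightarrow> (u2 has_vector_derivative u3 x) (at x within {0..L})"
    and "\<And>x. x \<in> {0..L} \<Longrightarrow> (u3 has_vector_derivative u4 x) (at x within {0..L})"
    and "\<And>x. x \<in> {0<..<L} \<Longrightarrow> of_real K * u4 x - of_real \<alpha> * lam\<^sup>2 * u2 x + lam\<^sup>2 * u x = 0"
    and "u 0 = 0" "u1 0 = 0" "u L = 0" "u2 L + of_real \<gamma> * lam * u1 L = 0"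
  shows "lam \<in> rayleigh_eigenvalues L \<alpha> K \<gamma>"
  unfolding rayleigh_eigenvalues_def rayleigh_eigenfunction_def mem_Collect_eq
  using assms by blast

lemma rayleigh_eigenvalueE:
  assumes "lam \<in> rayleigh_eigenvalues L \<alpha> K \<gamma>"
  obtains x0 u u1 u2 u3 u4 where "x0 \<in> {0<..<L}" "u x0 \<noteq> 0"
    and "\<forall>x\<in>{0..L}. (u has_vector_derivative u1 x) (at x within {0..L})"
    and "\<forall>x\<in>{0..L}. (u1 has_vector_derivative u2 x) (at x within {0..L})"
    and "\<forall>x\<in>{0..L}. (u2 has_vector_derivative u3 x) (at x within {0..L})"
    and "\<forall>x\<in>{0..L}. (u3 has_vector_derivative u4 x) (at x within {0..L})"
    and "\<forall>x\<in>{0<..<L}. of_real K * u4 x - of_real \<alpha> * lam\<^sup>2 * u2 x + lam\<^sup>2 * u x = 0"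
    and "u 0 = 0" "u1 0 = 0" "u L = 0" "u2 L + of_real \<gamma> * lam * u1 L = 0"
  using assms unfolding rayleigh_eigenvalues_def rayleigh_eigenfunction_def mem_Collect_eq
  by blast

text \<open>
  By uniqueness every function clamped at \<open>0\<close> that solves the equation is a combination of the two fundamental
  solutions, so that an eigenfunction amounts to a non-zero kernel vector of the \<open>2 \<times> 2\<close> system at \<open>L\<close>.
\<close>

lemma eigenvalue_iff_char:
  assumes L: "L > 0" and K: "K > 0"
  shows "lam \<in> rayleigh_eigenvalues L \<alpha> K \<gamma> \<longleftrightarrow> rayleigh_char L \<alpha> K \<gamma> lam = 0"
proof -
  define p q where "p = of_real \<alpha> * lam\<^sup>2 / of_real K" and "q = - lam\<^sup>2 / of_real K"
  define g where "g = (\<lambda>k. fund_sol k p q (of_real L))"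
  have ode: "of_real K * y4 - of_real \<alpha> * lam\<^sup>2 * y2 + lam\<^sup>2 * y = 0 \<longleftrightarrow> y4 = p * y2 + q * y" for y y2 y4
    using K by (auto simp: p_def q_def field_simps)
  have char: "rayleigh_char L \<alpha> K \<gamma> lam =
      g 1 * (g 2 + of_real \<gamma> * lam * g 1) - g 0 * (g 3 + of_real \<gamma> * lam * g 2)"
    by (simp add: rayleigh_char_def p_def q_def g_def)
  define w where "w = (\<lambda>a b k x. a * fund_sol (k + 1) p q (of_real x) + b * fund_sol k p q (complex_of_real x))"
  have w_jet: "beam_jet L p q (w a b)" for a b
    unfolding w_def using beam_jet_combine[OF fund_sol_jet[of L p q 1] fund_sol_jet[of L p q 0]] by simp
  have w_init: "w a b 0 0 = 0" "w a b 1 0 = 0" "w a b 2 0 = a" "w a b 3 0 = b" for a b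
    by (simp_all add: w_def fund_sol_at_0 eval_nat_numeral)
  have w_bc: "w a b 0 L = 0 \<and> w a b 2 L + of_real \<gamma> * lam * w a b 1 L = 0 \<longleftrightarrow>
      a * g 1 + b * g 0 = 0 \<and> a * (g 3 + of_real \<gamma> * lam * g 2) + b * (g 2 + of_real \<gamma> * lam * g 1) = 0" for a b
    by (simp add: w_def g_def eval_nat_numeral algebra_simps)
  have "lam \<in> rayleigh_eigenvalues L \<alpha> K \<gamma> \<longleftrightarrow>
     (\<exists>a b. (a \<noteq> 0 \<or> b \<noteq> 0) \<and> w a b 0 L = 0 \<and> w a b 2 L + of_real \<gamma> * lam * w a b 1 L = 0)"
  proof
    assume "lam \<in> rayleigh_eigenvalues L \<alpha> K \<gamma>"
    then obtain x0 u u1 u2 u3 u4 where x0: "x0 \<in> {0<..<L}" "u x0 \<noteq> 0"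
      and u: "\<forall>x\<in>{0..L}. (u has_vector_derivative u1 x) (at x within {0..L})"
      and u1: "\<forall>x\<in>{0..L}. (u1 has_vector_derivative u2 x) (at x within {0..L})"
      and u2: "\<forall>x\<in>{0..L}. (u2 has_vector_derivative u3 x) (at x within {0..L})"
      and u3: "\<forall>x\<in>{0..L}. (u3 has_vector_derivative u4 x) (at x within {0..L})"
      and eq: "\<forall>x\<in>{0<..<L}. of_real K * u4 x - of_real \<alpha> * lam\<^sup>2 * u2 x + lam\<^sup>2 * u x = 0"
      and bc: "u 0 = 0" "u1 0 = 0" "u L = 0" "u2 L + of_real \<gamma> * lam * u1 L = 0"
      by (rule rayleigh_eigenvalueE) blast
    note u = bspec[OF u] and u1 = bspec[OF u1] and u2 = bspec[OF u2] and u3 = bspec[OF u3]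
      and eq = eq[unfolded ode, THEN bspec]
    define v where "v = (\<lambda>k. [u, u1, u2, u3] ! k)"
    have v: "v 0 = u" "v (Suc 0) = u1" "v 2 = u2" "v 3 = u3" by (simp_all add: v_def)
    have v_jet: "beam_jet L p q v"
      unfolding beam_jet_def
    proof (intro conjI allI impI ballI)
      show "(v k has_vector_derivative v (Suc k) x) (at x within {0..L})"
        if "k < 3" "x \<in> {0..L}" for k x
      proof -
        have "k = 0 \<or> k = 1 \<or> k = 2" using that by auto
        then show ?thesis using u u1 u2 that by (auto simp: v_def)
      qed
      show "continuous_on {0..L} (v 3)"
        unfolding v continuous_on_eq_continuous_within using u3 has_vector_derivative_continuous by blast
      show "(v 3 has_vector_derivative p * v 2 x + q * v 0 x) (at x within {0..L})"
        if "x \<in> {0<..<L}" for x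
        using u3[of x] eq[OF that] that by (simp add: v)
    qed
    define a b where "a = u2 0" and "b = u3 0"
    have diff_jet: "beam_jet L p q (\<lambda>k x. 1 * v k x + (- 1) * w a b k x)"
      by (rule beam_jet_combine[OF v_jet w_jet])
    have init: "1 * v k 0 + (- 1) * w a b k 0 = 0" if "k < 4" for k
    proof -
      have "k = 0 \<or> k = 1 \<or> k = 2 \<or> k = 3" using that by auto
      then show ?thesis using w_init[of a b] bc by (auto simp: v a_def b_def)
    qed
    have vw: "u x = w a b 0 x" "u1 x = w a b 1 x" "u2 x = w a b 2 x" if "x \<in> {0..L}" for x
      using beam_jet_unique_zero[OF diff_jet init that] by (simp_all add: v)
    have "a \<noteq> 0 \<or> b \<noteq> 0"
      using x0 vw(1)[of x0] by (auto simp: w_def)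
    then show "\<exists>a b. (a \<noteq> 0 \<or> b \<noteq> 0) \<and> w a b 0 L = 0 \<and> w a b 2 L + of_real \<gamma> * lam * w a b 1 L = 0"
      using bc vw[of L] L by auto
  next
    assume "\<exists>a b. (a \<noteq> 0 \<or> b \<noteq> 0) \<and> w a b 0 L = 0 \<and> w a b 2 L + of_real \<gamma> * lam * w a b 1 L = 0"
    then obtain a b where ab: "a \<noteq> 0 \<or> b \<noteq> 0"
      and bc: "w a b 0 L = 0" "w a b 2 L + of_real \<gamma> * lam * w a b 1 L = 0" by blast
    have "\<exists>x\<in>{0<..<L}. w a b 0 x \<noteq> 0"
    proof (rule ccontr)
      assume "\<not> ?thesis"
      then have "w a b k 0 = 0" if "k < 4" for k
        using beam_jet_zero_at_0[OF w_jet[of a b] L _ that] by blast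
      from this[of 2] this[of 3] show False using w_init[of a b] ab by auto
    qed
    then obtain x0 where x0: "x0 \<in> {0<..<L}" "w a b 0 x0 \<noteq> 0" by blast
    have w_deriv: "(w a b k has_vector_derivative w a b j x) (at x within {0..L})" if "j = Suc k" for k j x
      unfolding w_def that using fund_sol_deriv[of "k + 1" p q "of_real x"] fund_sol_deriv[of k p q "of_real x"]
      by (intro has_vector_derivative_add has_vector_derivative_mult_right has_vector_derivative_real_field) auto
    have w_ode: "w a b 4 x = p * w a b 2 x + q * w a b 0 x" for x
      using fund_sol_ode[of 1 p q "of_real x"] fund_sol_ode[of 0 p q "of_real x"]
      by (simp add: w_def algebra_simps eval_nat_numeral)
    show "lam \<in> rayleigh_eigenvalues L \<alpha> K \<gamma>"
      by (rule rayleigh_eigenvalueI[OF x0 w_deriv[of 1] w_deriv[of 2] w_deriv[of 3] w_deriv[of 4]])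
         (use ode w_ode w_init[of a b] bc in auto)
  qed
  then show ?thesis
    unfolding w_bc char singular_2x2_iff .
qed

text \<open>
  For \<open>lam = 0\<close> the solutions are polynomials of degree at most \<open>3\<close> and the determinant is \<open>L^3 / 3\<close>. This is
  what rules out that the determinant vanishes identically.
\<close>

lemma char_at_0_nonzero:
  assumes "L > 0"
  shows "rayleigh_char L \<alpha> K \<gamma> 0 \<noteq> 0"
proof -
  have c: "taylor_coeff 0 0 n = (if n = 3 then 1 else 0)" for n
  proof (cases "n < 4")
    case True
    then have "n = 0 \<or> n = 1 \<or> n = 2 \<or> n = 3" by auto
    then show ?thesis by (auto simp: eval_nat_numeral)
  next
    case False
    then obtain k where "n = k + 4" by (metis add.commute le_Suc_ex not_less)
    then show ?thesis by (simp add: eval_nat_numeral)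
  qed
  have f: "fund_sol k 0 0 z = z ^ (3 - k) / fact (3 - k)" if "k \<le> 3" for k z
  proof -
    have "fund_sol k 0 0 z = (\<Sum>n. if n = 3 - k then z ^ n / fact n else 0)"
      unfolding fund_sol_def c by (rule suminf_cong) (use that in auto)
    then show ?thesis using sums_single[of "3 - k" "\<lambda>n. z ^ n / fact n"] by (simp add: sums_iff)
  qed
  have "rayleigh_char L \<alpha> K \<gamma> 0 = of_real (L ^ 3 / 3)"
    by (simp add: rayleigh_char_def f eval_nat_numeral field_simps)
  then show ?thesis using assms by (simp del: of_real_power of_real_divide)
qed

lemma char_holomorphic: "rayleigh_char L \<alpha> K \<gamma> holomorphic_on UNIV"
  unfolding rayleigh_char_def Let_def divide_inverse
  by (intro holomorphic_intros fund_sol_holomorphic)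

text \<open>
  Zeros of an entire function that is not identically zero do not accumulate.
\<close>

lemma finite_eigenvalues_in_disc:
  assumes "L > 0" "K > 0"
  shows "finite (rayleigh_eigenvalues L \<alpha> K \<gamma> \<inter> cball 0 R)"
proof (cases "rayleigh_char L \<alpha> K \<gamma> constant_on UNIV")
  case True
  then have "rayleigh_char L \<alpha> K \<gamma> lam \<noteq> 0" for lam
    using char_at_0_nonzero[OF assms(1)] unfolding constant_on_def by (metis UNIV_I)
  then have "rayleigh_eigenvalues L \<alpha> K \<gamma> = {}" using eigenvalue_iff_char[OF assms] by auto
  then show ?thesis by simp
next
  case False
  then have "finite {lam \<in> cball 0 R. rayleigh_char L \<alpha> K \<gamma> lam = 0}"
    by (intro holomorphic_compact_finite_zeros[OF char_holomorphic]) auto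
  then show ?thesis
    by (rule finite_subset[rotated]) (use eigenvalue_iff_char[OF assms] in auto)
qed

text \<open>
  All coefficients of the problem are real, so the conjugate of an eigenfunction is an eigenfunction.
\<close>

lemma eigenvalues_cnj:
  assumes "lam \<in> rayleigh_eigenvalues L \<alpha> K \<gamma>"
  shows "cnj lam \<in> rayleigh_eigenvalues L \<alpha> K \<gamma>"
proof -
  note d = bounded_linear.has_vector_derivative[OF bounded_linear_cnj]
  from assms obtain x0 u u1 u2 u3 u4 where x0: "x0 \<in> {0<..<L}" "u x0 \<noteq> 0"
      and u: "\<forall>x\<in>{0..L}. (u has_vector_derivative u1 x) (at x within {0..L})"
         "\<forall>x\<in>{0..L}. (u1 has_vector_derivative u2 x) (at x within {0..L})"
         "\<forall>x\<in>{0..L}. (u2 has_vector_derivative u3 x) (at x within {0..L})"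
         "\<forall>x\<in>{0..L}. (u3 has_vector_derivative u4 x) (at x within {0..L})"
      and ode: "\<forall>x\<in>{0<..<L}. of_real K * u4 x - of_real \<alpha> * lam\<^sup>2 * u2 x + lam\<^sup>2 * u x = 0"
      and bc0: "u 0 = 0" "u1 0 = 0" "u L = 0"
      and bc: "u2 L + of_real \<gamma> * lam * u1 L = 0"
    by (rule rayleigh_eigenvalueE) blast
  have ode': "of_real K * cnj (u4 x) - of_real \<alpha> * (cnj lam)\<^sup>2 * cnj (u2 x) + (cnj lam)\<^sup>2 * cnj (u x) = 0"
    if "x \<in> {0<..<L}" for x
    using arg_cong[OF bspec[OF ode that], of cnj]
    by (simp only: complex_cnj_add complex_cnj_diff complex_cnj_mult complex_cnj_power complex_cnj_zero
        complex_cnj_complex_of_real)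
  have bc': "cnj (u2 L) + of_real \<gamma> * cnj lam * cnj (u1 L) = 0"
    using arg_cong[OF bc, of cnj]
    by (simp only: complex_cnj_add complex_cnj_mult complex_cnj_zero complex_cnj_complex_of_real)
  show ?thesis
    by (rule rayleigh_eigenvalueI[of x0 L "\<lambda>x. cnj (u x)", OF _ _ d[OF u(1)[THEN bspec]]
          d[OF u(2)[THEN bspec]] d[OF u(3)[THEN bspec]] d[OF u(4)[THEN bspec]] ode' _ _ _ bc'])
       (use x0 bc0 in auto)
qed

section \<open>The determinant for large spectral parameter\<close>

text \<open>
  For \<open>lam \<noteq> 0\<close> the characteristic roots \<open>\<plusminus> m, \<plusminus> n\<close> of \<open>K m^4 - \<alpha> lam^2 m^2 + lam^2 = 0\<close> satisfy
  \<open>m^2 n^2 = lam^2 / K\<close> and \<open>m^2 + n^2 = \<alpha> lam^2 / K\<close>, hence \<open>1 / m^2 + 1 / n^2 = \<alpha>\<close>. So a large root \<open>m\<close>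
  determines the other one as \<open>n = small_root \<alpha> (1 / m)\<close>, which is close to \<open>1 / sqrt \<alpha>\<close>, and then
  \<open>lam = sqrt K m n\<close>. In the variable \<open>\<zeta> = 1 / m\<close> everything is analytic at \<open>0\<close>.
\<close>

definition small_root :: "real \<Rightarrow> complex \<Rightarrow> complex" where
  "small_root \<alpha> \<zeta> = 1 / csqrt (of_real \<alpha> - \<zeta>\<^sup>2)"

definition beam_lambda :: "real \<Rightarrow> real \<Rightarrow> complex \<Rightarrow> complex" where
  "beam_lambda \<alpha> K m = of_real (sqrt K) * m * small_root \<alpha> (1 / m)"

text \<open>
  The next three functions are the coefficients of \<open>cosh (m L)\<close>, of \<open>sinh (m L)\<close> and of \<open>1\<close> in the
  characteristic determinant, after multiplication by \<open>(m^2 - n^2)^2 n / m^2\<close>; this normalisation is chosen such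
  that they have finite limits as \<open>\<zeta> = 1 / m\<close> tends to \<open>0\<close>, the last one being \<open>0\<close>.
\<close>

definition cosh_coeff :: "real \<Rightarrow> real \<Rightarrow> real \<Rightarrow> real \<Rightarrow> complex \<Rightarrow> complex" where
  "cosh_coeff L \<alpha> K \<gamma> \<zeta> = (let n = small_root \<alpha> \<zeta> in
     (1 - n\<^sup>2 * \<zeta>\<^sup>2) * sinh (n * of_real L) - 2 * of_real (\<gamma> * sqrt K) * n\<^sup>2 * \<zeta> * cosh (n * of_real L))"

definition sinh_coeff :: "real \<Rightarrow> real \<Rightarrow> real \<Rightarrow> real \<Rightarrow> complex \<Rightarrow> complex" where
  "sinh_coeff L \<alpha> K \<gamma> \<zeta> = (let n = small_root \<alpha> \<zeta> in
     of_real (\<gamma> * sqrt K) * n * (1 + n\<^sup>2 * \<zeta>\<^sup>2) * sinh (n * of_real L)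
       - \<zeta> * (1 - n\<^sup>2 * \<zeta>\<^sup>2) * n * cosh (n * of_real L))"

definition const_coeff :: "real \<Rightarrow> real \<Rightarrow> real \<Rightarrow> complex \<Rightarrow> complex" where
  "const_coeff \<alpha> K \<gamma> \<zeta> = 2 * of_real (\<gamma> * sqrt K) * (small_root \<alpha> \<zeta>)\<^sup>2 * \<zeta>"

text \<open>
  The determinant is quadratic in the hyperbolic functions, but the squares enter only through
  \<open>C1^2 - S1^2 = 1\<close> and \<open>C2^2 - S2^2 = 1\<close>, and the products \<open>C1 S1\<close> and \<open>C2 S2\<close> cancel. So it is affine in
  \<open>(C1, S1)\<close>, which belong to the large root.
\<close>

lemma beam_determinant_identity:
  fixes m n k C1 C2 S1 S2 \<gamma> :: "'a::field"
  assumes "m \<noteq> 0" "n \<noteq> 0" "C1\<^sup>2 = 1 + S1\<^sup>2" "C2\<^sup>2 = 1 + S2\<^sup>2"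
  shows "(C1 - C2) * ((m * S1 - n * S2) + \<gamma> * (k * m * n) * (C1 - C2))
       - (S1 / m - S2 / n) * ((m\<^sup>2 * C1 - n\<^sup>2 * C2) + \<gamma> * (k * m * n) * (m * S1 - n * S2))
     = m\<^sup>2 / n * (((1 - n\<^sup>2 * (1 / m)\<^sup>2) * S2 - 2 * (\<gamma> * k) * n\<^sup>2 * (1 / m) * C2) * C1
        + (\<gamma> * k * n * (1 + n\<^sup>2 * (1 / m)\<^sup>2) * S2 - (1 / m) * (1 - n\<^sup>2 * (1 / m)\<^sup>2) * n * C2) * S1
        + 2 * (\<gamma> * k) * n\<^sup>2 * (1 / m))"
proof -
  \<comment> \<open>The quotients S1 / m and S2 / n turn the claim into a polynomial identity.\<close>
  define s1 s2 where "s1 = S1 / m" and "s2 = S2 / n"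
  have S: "S1 = m * s1" "S2 = n * s2" using assms by (simp_all add: s1_def s2_def)
  have sq: "C1 * C1 = 1 + m * m * s1 * s1" "C2 * C2 = 1 + n * n * s2 * s2"
    using assms(3,4) by (simp_all add: S power2_eq_square mult_ac)
  have "m\<^sup>2 / n * (((1 - n\<^sup>2 * (1 / m)\<^sup>2) * S2 - 2 * (\<gamma> * k) * n\<^sup>2 * (1 / m) * C2) * C1
        + (\<gamma> * k * n * (1 + n\<^sup>2 * (1 / m)\<^sup>2) * S2 - (1 / m) * (1 - n\<^sup>2 * (1 / m)\<^sup>2) * n * C2) * S1
        + 2 * (\<gamma> * k) * n\<^sup>2 * (1 / m))
    = 2 * \<gamma> * k * m * n * (1 - C1 * C2) + \<gamma> * k * (m\<^sup>2 + n\<^sup>2) * (m * s1) * (n * s2)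
       + (m\<^sup>2 - n\<^sup>2) * (C1 * s2 - s1 * C2)"
    using assms(1,2) unfolding S by (simp add: divide_simps) (simp add: algebra_simps power2_eq_square)
  also have "\<dots> = (C1 - C2) * ((m * (m * s1) - n * (n * s2)) + \<gamma> * (k * m * n) * (C1 - C2))
       - (s1 - s2) * ((m\<^sup>2 * C1 - n\<^sup>2 * C2) + \<gamma> * (k * m * n) * (m * (m * s1) - n * (n * s2)))"
    using sq by algebra
  finally show ?thesis using assms(1,2) by (simp add: S)
qed

lemma fund_sol_hyperbolic:
  assumes "m \<noteq> 0" "n \<noteq> 0" "m\<^sup>2 \<noteq> n\<^sup>2"
  defines "f \<equiv> \<lambda>k. fund_sol k (m\<^sup>2 + n\<^sup>2) (- (m\<^sup>2 * n\<^sup>2))"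
  shows "f 0 z = (sinh (m * z) / m - sinh (n * z) / n) / (m\<^sup>2 - n\<^sup>2)"
    and "f 1 z = (cosh (m * z) - cosh (n * z)) / (m\<^sup>2 - n\<^sup>2)"
    and "f 2 z = (m * sinh (m * z) - n * sinh (n * z)) / (m\<^sup>2 - n\<^sup>2)"
    and "f 3 z = (m\<^sup>2 * cosh (m * z) - n\<^sup>2 * cosh (n * z)) / (m\<^sup>2 - n\<^sup>2)"
proof -
  have e: "f k z = (E k m - E k n) / (m\<^sup>2 - n\<^sup>2)"
    if "\<And>w. w \<noteq> 0 \<Longrightarrow> (w ^ k * exp (w * z) - (- w) ^ k * exp (- w * z)) / (2 * w) = E k w" for k E
    unfolding f_def fund_sol_closed_form[OF assms(1-3)] using that assms by simp
  show "f 0 z = (sinh (m * z) / m - sinh (n * z) / n) / (m\<^sup>2 - n\<^sup>2)"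
    by (rule e[of 0 "\<lambda>_ w. sinh (w * z) / w"]) (simp add: sinh_field_def)
  show "f 1 z = (cosh (m * z) - cosh (n * z)) / (m\<^sup>2 - n\<^sup>2)"
    by (rule e[of 1 "\<lambda>_ w. cosh (w * z)"]) (simp add: cosh_field_def field_simps)
  show "f 2 z = (m * sinh (m * z) - n * sinh (n * z)) / (m\<^sup>2 - n\<^sup>2)"
    by (rule e[of 2 "\<lambda>_ w. w * sinh (w * z)"]) (simp add: sinh_field_def field_simps power2_eq_square)
  show "f 3 z = (m\<^sup>2 * cosh (m * z) - n\<^sup>2 * cosh (n * z)) / (m\<^sup>2 - n\<^sup>2)"
    by (rule e[of 3 "\<lambda>_ w. w\<^sup>2 * cosh (w * z)"]) (simp add: cosh_field_def field_simps eval_nat_numeral)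
qed

lemma char_eq_0_iff_hyperbolic:
  assumes K: "K > 0" and m: "m \<noteq> 0" and n: "n \<noteq> 0" "1 - n\<^sup>2 * (1 / m)\<^sup>2 \<noteq> 0"
    and n_def: "n = small_root \<alpha> (1 / m)"
  shows "rayleigh_char L \<alpha> K \<gamma> (beam_lambda \<alpha> K m) = 0 \<longleftrightarrow>
     cosh_coeff L \<alpha> K \<gamma> (1 / m) * cosh (m * of_real L)
     + sinh_coeff L \<alpha> K \<gamma> (1 / m) * sinh (m * of_real L) + const_coeff \<alpha> K \<gamma> (1 / m) = 0"
proof -
  define lam where "lam = beam_lambda \<alpha> K m"
  define k :: complex where "k = of_real (sqrt K)"
  have lam: "lam = k * m * n" by (simp add: lam_def beam_lambda_def k_def n_def)
  have k2: "k\<^sup>2 = of_real K" using K by (simp add: k_def flip: of_real_power)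
  have "n\<^sup>2 * (of_real \<alpha> - (1 / m)\<^sup>2) = 1"
    using n(1) by (auto simp: n_def small_root_def power_divide)
  moreover have "m\<^sup>2 * (1 / m)\<^sup>2 = 1" using m by (simp add: power_divide)
  ultimately have n2: "m\<^sup>2 + n\<^sup>2 = of_real \<alpha> * (m\<^sup>2 * n\<^sup>2)" by algebra
  have K0: "of_real K \<noteq> (0::complex)" using K by simp
  have lam2: "lam\<^sup>2 / of_real K = m\<^sup>2 * n\<^sup>2"
    unfolding lam power_mult_distrib k2 using K0 by simp
  have pq: "of_real \<alpha> * lam\<^sup>2 / of_real K = m\<^sup>2 + n\<^sup>2" "- lam\<^sup>2 / of_real K = - (m\<^sup>2 * n\<^sup>2)"
    using lam2 n2 by (simp_all add: times_divide_eq_right[symmetric] del: times_divide_eq_right)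
  have ne: "m\<^sup>2 \<noteq> n\<^sup>2" using n(2) m by (auto simp: field_simps)
  then have d: "m\<^sup>2 - n\<^sup>2 \<noteq> 0" by simp
  let ?z = "complex_of_real L"
  have "rayleigh_char L \<alpha> K \<gamma> lam = ((cosh (m * ?z) - cosh (n * ?z)) *
        ((m * sinh (m * ?z) - n * sinh (n * ?z)) + of_real \<gamma> * (k * m * n) * (cosh (m * ?z) - cosh (n * ?z)))
       - (sinh (m * ?z) / m - sinh (n * ?z) / n) *
        ((m\<^sup>2 * cosh (m * ?z) - n\<^sup>2 * cosh (n * ?z))
         + of_real \<gamma> * (k * m * n) * (m * sinh (m * ?z) - n * sinh (n * ?z)))) / (m\<^sup>2 - n\<^sup>2)\<^sup>2"
  proof -
    have "(A / d) * (B / d + g * (A / d)) - (E / d) * (F / d + g * (B / d))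
        = (A * (B + g * A) - E * (F + g * B)) / d\<^sup>2" for A B E F g d :: complex
      by (simp add: add_divide_distrib diff_divide_distrib power2_eq_square algebra_simps)
    then show ?thesis
      unfolding rayleigh_char_def Let_def pq fund_sol_hyperbolic[OF m n(1) ne] unfolding lam .
  qed
  also have "\<dots> = m\<^sup>2 / n * (cosh_coeff L \<alpha> K \<gamma> (1 / m) * cosh (m * ?z)
     + sinh_coeff L \<alpha> K \<gamma> (1 / m) * sinh (m * ?z) + const_coeff \<alpha> K \<gamma> (1 / m)) / (m\<^sup>2 - n\<^sup>2)\<^sup>2"
    by (subst beam_determinant_identity[OF m n(1)])
       (simp_all add: cosh_square_eq cosh_coeff_def sinh_coeff_def const_coeff_def Let_def k_def flip: n_def)
  finally show ?thesis using m n d unfolding lam_def by simp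
qed

text \<open>
  Multiplication by \<open>2 exp w\<close> turns the equation into a quadratic one for \<open>exp w\<close>.
\<close>

lemma hyperbolic_eq_0_iff:
  fixes a b c w :: complex
  assumes "a + b \<noteq> 0"
  shows "a * cosh w + b * sinh w + c = 0 \<longleftrightarrow>
     exp (2 * w) = (b - a) / (a + b) + (- 2 * c / (a + b)) * exp w"
proof -
  have e: "exp (- w) * exp w = 1" by (simp add: exp_minus)
  have "2 * cosh w = exp w + exp (- w)" "2 * sinh w = exp w - exp (- w)"
    by (simp_all add: cosh_field_def sinh_field_def)
  then have "2 * exp w * (a * cosh w + b * sinh w + c)
      = (a + b) * (exp w * exp w) + (a - b) * (exp (- w) * exp w) + 2 * c * exp w"
    by algebra
  also have "\<dots> = (a + b) * (exp (2 * w) - ((b - a) / (a + b) + (- 2 * c / (a + b)) * exp w))"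
  proof -
    have "(a + b) * ((b - a) / (a + b)) = b - a" "(a + b) * (- 2 * c / (a + b) * exp w) = - 2 * c * exp w"
      using assms by simp_all
    then show ?thesis
      unfolding e exp_double power2_eq_square by algebra
  qed
  finally have *: "2 * exp w * (a * cosh w + b * sinh w + c)
      = (a + b) * (exp (2 * w) - ((b - a) / (a + b) + (- 2 * c / (a + b)) * exp w))" .
  have "a * cosh w + b * sinh w + c = 0 \<longleftrightarrow> 2 * exp w * (a * cosh w + b * sinh w + c) = 0" by simp
  also have "\<dots> \<longleftrightarrow> exp (2 * w) - ((b - a) / (a + b) + (- 2 * c / (a + b)) * exp w) = 0"
    unfolding * using assms by simp
  finally show ?thesis by simp
qed

definition free_coeff :: "real \<Rightarrow> real \<Rightarrow> real \<Rightarrow> real \<Rightarrow> complex \<Rightarrow> complex" where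
  "free_coeff L \<alpha> K \<gamma> \<zeta> = (sinh_coeff L \<alpha> K \<gamma> \<zeta> - cosh_coeff L \<alpha> K \<gamma> \<zeta>)
     / (cosh_coeff L \<alpha> K \<gamma> \<zeta> + sinh_coeff L \<alpha> K \<gamma> \<zeta>)"

definition exp_coeff :: "real \<Rightarrow> real \<Rightarrow> real \<Rightarrow> real \<Rightarrow> complex \<Rightarrow> complex" where
  "exp_coeff L \<alpha> K \<gamma> \<zeta> = - 2 * const_coeff \<alpha> K \<gamma> \<zeta>
     / (cosh_coeff L \<alpha> K \<gamma> \<zeta> + sinh_coeff L \<alpha> K \<gamma> \<zeta>)"

lemma small_root_at_0: "\<alpha> > 0 \<Longrightarrow> small_root \<alpha> 0 = of_real (1 / sqrt \<alpha>)"
  by (simp add: small_root_def)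

lemma small_root_analytic: "\<alpha> > 0 \<Longrightarrow> small_root \<alpha> analytic_on {0}"
  unfolding small_root_def by (intro analytic_intros) auto

lemma coeffs_at_0:
  assumes "\<alpha> > 0"
  shows "cosh_coeff L \<alpha> K \<gamma> 0 = of_real (sinh (L / sqrt \<alpha>))"
    and "sinh_coeff L \<alpha> K \<gamma> 0 = of_real (\<gamma> * sqrt (K / \<alpha>) * sinh (L / sqrt \<alpha>))"
    and "const_coeff \<alpha> K \<gamma> 0 = 0"
proof -
  have "sinh (complex_of_real x) = of_real (sinh x)" for x
    by (simp add: sinh_field_def exp_of_real flip: of_real_minus)
  moreover have "small_root \<alpha> 0 * of_real L = of_real (L / sqrt \<alpha>)"
    using assms by (simp add: small_root_at_0)
  ultimately have "sinh (small_root \<alpha> 0 * of_real L) = of_real (sinh (L / sqrt \<alpha>))"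
    by metis
  then show "cosh_coeff L \<alpha> K \<gamma> 0 = of_real (sinh (L / sqrt \<alpha>))"
    and "sinh_coeff L \<alpha> K \<gamma> 0 = of_real (\<gamma> * sqrt (K / \<alpha>) * sinh (L / sqrt \<alpha>))"
    and "const_coeff \<alpha> K \<gamma> 0 = 0"
    using assms by (simp_all add: cosh_coeff_def sinh_coeff_def const_coeff_def Let_def small_root_at_0
        real_sqrt_divide)
qed

lemma coeffs_analytic:
  assumes "\<alpha> > 0"
  shows "cosh_coeff L \<alpha> K \<gamma> analytic_on {0}" "sinh_coeff L \<alpha> K \<gamma> analytic_on {0}"
    "const_coeff \<alpha> K \<gamma> analytic_on {0}"
  unfolding cosh_coeff_def sinh_coeff_def const_coeff_def Let_def
  by (intro analytic_intros small_root_analytic assms)+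

text \<open>
  As \<open>m\<close> tends to infinity the equation becomes
  \<open>exp (2 L m) = (\<gamma> s - 1) / (\<gamma> s + 1)\<close> with \<open>s = sqrt (K / \<alpha>)\<close>: the damping enters the limit as a reflection
  coefficient, and it vanishes exactly for the excluded value of \<open>\<gamma>\<close>.
\<close>

lemma quasi_polynomial_coeffs:
  assumes L: "L > 0" and \<alpha>: "\<alpha> > 0" and K: "K > 0" and \<gamma>: "\<gamma> > 0"
  shows "cosh_coeff L \<alpha> K \<gamma> 0 + sinh_coeff L \<alpha> K \<gamma> 0 \<noteq> 0"
    and "free_coeff L \<alpha> K \<gamma> analytic_on {0}" "exp_coeff L \<alpha> K \<gamma> analytic_on {0}"
    and "exp_coeff L \<alpha> K \<gamma> 0 = 0"
    and "free_coeff L \<alpha> K \<gamma> 0 = of_real ((\<gamma> * sqrt (K / \<alpha>) - 1) / (\<gamma> * sqrt (K / \<alpha>) + 1))"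
proof -
  define s where "s = \<gamma> * sqrt (K / \<alpha>)"
  have s: "s > 0" using assms by (simp add: s_def)
  have sh: "sinh (L / sqrt \<alpha>) > 0" using L \<alpha> by simp
  have sum: "cosh_coeff L \<alpha> K \<gamma> 0 + sinh_coeff L \<alpha> K \<gamma> 0 = of_real ((s + 1) * sinh (L / sqrt \<alpha>))"
    using coeffs_at_0[OF \<alpha>] by (simp add: s_def algebra_simps)
  moreover have "(s + 1) * sinh (L / sqrt \<alpha>) \<noteq> 0" using s sh by auto
  ultimately show nz: "cosh_coeff L \<alpha> K \<gamma> 0 + sinh_coeff L \<alpha> K \<gamma> 0 \<noteq> 0" by (metis of_real_eq_0_iff)
  show "free_coeff L \<alpha> K \<gamma> analytic_on {0}" "exp_coeff L \<alpha> K \<gamma> analytic_on {0}"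
    unfolding free_coeff_def exp_coeff_def
    using nz by (intro analytic_intros coeffs_analytic \<alpha>; simp)+
  show "exp_coeff L \<alpha> K \<gamma> 0 = 0" by (simp add: exp_coeff_def coeffs_at_0[OF \<alpha>])
  have "free_coeff L \<alpha> K \<gamma> 0 = of_real ((s - 1) * sinh (L / sqrt \<alpha>)) / of_real ((s + 1) * sinh (L / sqrt \<alpha>))"
    unfolding free_coeff_def sum using coeffs_at_0[OF \<alpha>] by (simp add: s_def algebra_simps)
  also have "\<dots> = of_real ((s - 1) / (s + 1))"
    using sh nonzero_mult_divide_mult_cancel_right[of "sinh (L / sqrt \<alpha>)" "s - 1" "s + 1"]
    by (metis less_irrefl of_real_divide)
  finally show "free_coeff L \<alpha> K \<gamma> 0 = of_real ((\<gamma> * sqrt (K / \<alpha>) - 1) / (\<gamma> * sqrt (K / \<alpha>) + 1))"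
    by (simp add: s_def)
qed

lemma eventually_at_infinity_inverse:
  fixes P :: "complex \<Rightarrow> bool"
  assumes "eventually P (nhds 0)"
  shows "eventually (\<lambda>m. P (1 / m)) at_infinity"
proof -
  have "filterlim (\<lambda>m::complex. 1 / m) (nhds 0) at_infinity"
    using tendsto_inverse_0 by (simp add: inverse_eq_divide[abs_def])
  then show ?thesis using assms by (simp add: filterlim_iff)
qed

lemma analytic_eventually_nonzero:
  fixes f :: "complex \<Rightarrow> complex"
  assumes "f analytic_on {0}" "f 0 \<noteq> 0"
  shows "eventually (\<lambda>\<zeta>. f \<zeta> \<noteq> 0) (nhds 0)"
proof -
  have "isCont f 0"
    using assms(1) analytic_at_imp_isCont by blast
  then have "(f \<longlongrightarrow> f 0) (nhds 0)" by (simp add: isCont_def tendsto_at_iff_tendsto_nhds)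
  then show ?thesis using assms(2) by (rule tendsto_imp_eventually_ne)
qed

text \<open>
  The source of all error terms \<open>O(1 / m)\<close>, with \<open>\<zeta> = 1 / m\<close>.
\<close>

lemma analytic_eventually_lipschitz_at_0:
  fixes f :: "complex \<Rightarrow> complex"
  assumes "f analytic_on {0}"
  obtains C where "C > 0" "eventually (\<lambda>\<zeta>. norm (f \<zeta> - f 0) \<le> C * norm \<zeta>) (nhds 0)"
proof -
  obtain f' where "(f has_field_derivative f') (at 0)"
    using assms analytic_on_imp_differentiable_at field_differentiable_def by blast
  then have "((\<lambda>\<zeta>. (f \<zeta> - f 0) / \<zeta>) \<longlongrightarrow> f') (at 0)"
    by (simp add: has_field_derivative_iff)
  then have "eventually (\<lambda>\<zeta>. dist ((f \<zeta> - f 0) / \<zeta>) f' < 1) (at 0)"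
    by (rule tendstoD) simp
  then have "eventually (\<lambda>\<zeta>. norm (f \<zeta> - f 0) \<le> (norm f' + 1) * norm \<zeta>) (at 0)"
  proof (rule eventually_mono[OF eventually_conj[OF _ eventually_neq_at_within[of 0]]])
    fix \<zeta> assume *: "dist ((f \<zeta> - f 0) / \<zeta>) f' < 1 \<and> \<zeta> \<noteq> 0"
    then have "norm ((f \<zeta> - f 0) / \<zeta>) \<le> norm f' + 1"
      using norm_triangle_ineq2[of "(f \<zeta> - f 0) / \<zeta>" f'] by (simp add: dist_norm)
    then show "norm (f \<zeta> - f 0) \<le> (norm f' + 1) * norm \<zeta>"
      using * by (simp add: norm_divide divide_simps)
  qed
  then have "eventually (\<lambda>\<zeta>. norm (f \<zeta> - f 0) \<le> (norm f' + 1) * norm \<zeta>) (nhds 0)"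
    by (auto simp: eventually_at_filter elim: eventually_mono)
  moreover have "norm f' + 1 > 0" by (simp add: add_nonneg_pos)
  ultimately show ?thesis using that by blast
qed

text \<open>
  The divisions on the way are by functions of \<open>1 / m\<close> that are analytic and non-zero at \<open>0\<close>, hence non-zero for all
  large \<open>m\<close>.
\<close>

lemma eigenvalue_iff_quasi_polynomial:
  assumes L: "L > 0" and \<alpha>: "\<alpha> > 0" and K: "K > 0" and \<gamma>: "\<gamma> > 0"
  shows "eventually (\<lambda>m. beam_lambda \<alpha> K m \<in> rayleigh_eigenvalues L \<alpha> K \<gamma> \<longleftrightarrow>
     exp (2 * of_real L * m) = free_coeff L \<alpha> K \<gamma> (1 / m) + exp_coeff L \<alpha> K \<gamma> (1 / m) * exp (of_real L * m)) at_infinity"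
proof -
  have "eventually (\<lambda>\<zeta>. small_root \<alpha> \<zeta> \<noteq> 0) (nhds 0)"
    by (rule analytic_eventually_nonzero) (use small_root_analytic small_root_at_0 \<alpha> in auto)
  moreover have "eventually (\<lambda>\<zeta>. 1 - (small_root \<alpha> \<zeta>)\<^sup>2 * \<zeta>\<^sup>2 \<noteq> 0) (nhds 0)"
    by (rule analytic_eventually_nonzero) (intro analytic_intros small_root_analytic \<alpha> | simp)+
  moreover have "eventually (\<lambda>\<zeta>. cosh_coeff L \<alpha> K \<gamma> \<zeta> + sinh_coeff L \<alpha> K \<gamma> \<zeta> \<noteq> 0) (nhds 0)"
    by (rule analytic_eventually_nonzero)
       (intro analytic_intros coeffs_analytic \<alpha> quasi_polynomial_coeffs(1)[OF assms])+
  ultimately have "eventually (\<lambda>\<zeta>. small_root \<alpha> \<zeta> \<noteq> 0 \<and> 1 - (small_root \<alpha> \<zeta>)\<^sup>2 * \<zeta>\<^sup>2 \<noteq> 0 \<and>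
      cosh_coeff L \<alpha> K \<gamma> \<zeta> + sinh_coeff L \<alpha> K \<gamma> \<zeta> \<noteq> 0) (nhds 0)"
    by (intro eventually_conj)
  from eventually_at_infinity_inverse[OF this] eventually_not_equal_at_infinity[of 0]
  show ?thesis
  proof eventually_elim
    case (elim m)
    then have "beam_lambda \<alpha> K m \<in> rayleigh_eigenvalues L \<alpha> K \<gamma> \<longleftrightarrow>
        cosh_coeff L \<alpha> K \<gamma> (1 / m) * cosh (m * of_real L)
       + sinh_coeff L \<alpha> K \<gamma> (1 / m) * sinh (m * of_real L) + const_coeff \<alpha> K \<gamma> (1 / m) = 0"
      using eigenvalue_iff_char[OF L K] char_eq_0_iff_hyperbolic[OF K _ _ _ refl] by simp
    also have "\<dots> \<longleftrightarrow> exp (2 * (m * of_real L))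
        = free_coeff L \<alpha> K \<gamma> (1 / m) + exp_coeff L \<alpha> K \<gamma> (1 / m) * exp (m * of_real L)"
      unfolding free_coeff_def exp_coeff_def by (rule hyperbolic_eq_0_iff) (use elim in simp)
    finally show ?case by (simp add: mult_ac)
  qed
qed

text \<open>
  The small root depends on \<open>\<zeta> = 1 / m\<close> through \<open>\<zeta>^2\<close> only. So it differs from its limit by \<open>O(1 / m^2)\<close>, and the
  factor \<open>m\<close> in \<open>lam\<close> still leaves an error \<open>O(1 / m)\<close>.
\<close>

lemma beam_lambda_asymp:
  assumes \<alpha>: "\<alpha> > 0" and K: "K > 0"
  obtains C where "C > 0"
    "eventually (\<lambda>m. norm (beam_lambda \<alpha> K m - of_real (sqrt (K / \<alpha>)) * m) \<le> C / norm m) at_infinity"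
proof -
  define h where "h = (\<lambda>w. 1 / csqrt (of_real \<alpha> - w))"
  have "h analytic_on {0}" unfolding h_def by (intro analytic_intros) (use \<alpha> in auto)
  then obtain C where C: "C > 0" and ev: "eventually (\<lambda>w. norm (h w - h 0) \<le> C * norm w) (nhds 0)"
    by (rule analytic_eventually_lipschitz_at_0)
  have "filterlim (\<lambda>\<zeta>::complex. \<zeta>\<^sup>2) (nhds 0) (nhds 0)"
    using tendsto_power[OF filterlim_ident[of "nhds (0::complex)"], of 2] by simp
  then have "eventually (\<lambda>\<zeta>. norm (h (\<zeta>\<^sup>2) - h 0) \<le> C * norm (\<zeta>\<^sup>2)) (nhds 0)"
    by (rule eventually_compose_filterlim[OF ev])
  from eventually_at_infinity_inverse[OF this] eventually_not_equal_at_infinity[of 0]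
  have "eventually (\<lambda>m. norm (beam_lambda \<alpha> K m - of_real (sqrt (K / \<alpha>)) * m) \<le> (sqrt K * C) / norm m) at_infinity"
  proof eventually_elim
    case (elim m)
    have "beam_lambda \<alpha> K m - of_real (sqrt (K / \<alpha>)) * m = of_real (sqrt K) * m * (h ((1 / m)\<^sup>2) - h 0)"
      using \<alpha> by (simp add: beam_lambda_def small_root_def h_def real_sqrt_divide field_simps)
    then have "norm (beam_lambda \<alpha> K m - of_real (sqrt (K / \<alpha>)) * m)
        = sqrt K * norm m * norm (h ((1 / m)\<^sup>2) - h 0)"
      using K by (simp add: norm_mult)
    also have "\<dots> \<le> sqrt K * norm m * (C * norm ((1 / m)\<^sup>2))"
      using elim K by (intro mult_left_mono) auto
    also have "\<dots> = sqrt K * C / norm m"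
      using elim by (simp add: norm_power norm_divide norm_mult power2_eq_square)
    finally show ?case .
  qed
  then show ?thesis using that[of "sqrt K * C"] C K by simp
qed

text \<open>
  Of the two roots of the characteristic equation, as a quadratic equation for \<open>m^2\<close>, the larger one is at least
  half of their sum \<open>\<alpha> lam^2 / K\<close>. The sign of \<open>m\<close> is then fixed by that of \<open>lam\<close>, because \<open>beam_lambda\<close> is odd in \<open>m\<close>.
\<close>

lemma beam_lambda_surj:
  assumes \<alpha>: "\<alpha> > 0" and K: "K > 0"
  obtains R' where "\<forall>lam. norm lam \<ge> R' \<longrightarrow> (\<exists>m. norm m \<ge> R \<and> lam = beam_lambda \<alpha> K m)"
proof (rule that, intro allI impI)
  fix lam :: complex
  assume lam: "norm lam \<ge> max 1 (R\<^sup>2 * (2 * K / \<alpha>))"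
  obtain m1 m2 where m12: "of_real \<alpha> * lam\<^sup>2 / of_real K = m1\<^sup>2 + m2\<^sup>2"
      "- (lam\<^sup>2 / of_real K) = - (m1\<^sup>2 * m2\<^sup>2)"
    by (rule biquadratic_roots)
  have "\<exists>m n. of_real \<alpha> * lam\<^sup>2 / of_real K = m\<^sup>2 + n\<^sup>2 \<and> lam\<^sup>2 / of_real K = m\<^sup>2 * n\<^sup>2 \<and> norm n \<le> norm m"
    using m12 by (cases "norm m1 \<le> norm m2") (force simp: add.commute mult.commute)+
  then obtain m n where mn: "of_real \<alpha> * lam\<^sup>2 / of_real K = m\<^sup>2 + n\<^sup>2" "lam\<^sup>2 / of_real K = m\<^sup>2 * n\<^sup>2"
    and le: "norm n \<le> norm m" by blast
  have "\<alpha> / K * (norm lam)\<^sup>2 = norm (m\<^sup>2 + n\<^sup>2)"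
    using \<alpha> K by (simp add: norm_mult norm_divide norm_power flip: mn(1))
  also have "\<dots> \<le> 2 * (norm m)\<^sup>2"
  proof -
    have "norm (m\<^sup>2 + n\<^sup>2) \<le> (norm m)\<^sup>2 + (norm n)\<^sup>2"
      using norm_triangle_ineq[of "m\<^sup>2" "n\<^sup>2"] by (simp add: norm_power)
    moreover have "(norm n)\<^sup>2 \<le> (norm m)\<^sup>2" using le by (intro power_mono) auto
    ultimately show ?thesis by linarith
  qed
  finally have m_ge: "\<alpha> / K * (norm lam)\<^sup>2 \<le> 2 * (norm m)\<^sup>2" .
  have "R\<^sup>2 * (2 * K / \<alpha>) \<le> norm lam" using lam by simp
  also have "\<dots> \<le> (norm lam)\<^sup>2" using lam by (intro self_le_power) auto
  finally have "\<alpha> / K * (R\<^sup>2 * (2 * K / \<alpha>)) \<le> \<alpha> / K * (norm lam)\<^sup>2"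
    using \<alpha> K by (intro mult_left_mono) auto
  moreover have "\<alpha> / K * (R\<^sup>2 * (2 * K / \<alpha>)) = 2 * R\<^sup>2" using \<alpha> K by simp
  ultimately have "R\<^sup>2 \<le> (norm m)\<^sup>2" using m_ge by linarith
  then have R: "R \<le> norm m" by (rule power2_le_imp_le) simp
  have "lam \<noteq> 0" using lam by auto
  then have nz: "m \<noteq> 0" "n \<noteq> 0" using mn(2) K by auto
  have "m\<^sup>2 + n\<^sup>2 = of_real \<alpha> * (m\<^sup>2 * n\<^sup>2)"
    using mn by (simp flip: times_divide_eq_right)
  then have "of_real \<alpha> - (1 / m)\<^sup>2 = 1 / n\<^sup>2" using nz by (simp add: field_simps)
  then have "(beam_lambda \<alpha> K m)\<^sup>2 = of_real K * m\<^sup>2 * n\<^sup>2"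
    using K by (simp add: beam_lambda_def small_root_def power_mult_distrib power_divide flip: of_real_power)
  also have "\<dots> = lam\<^sup>2" using mn(2) K by (simp add: field_simps)
  finally have "lam = beam_lambda \<alpha> K m \<or> lam = beam_lambda \<alpha> K (- m)"
    by (auto simp: power2_eq_iff beam_lambda_def small_root_def)
  then show "\<exists>m. norm m \<ge> R \<and> lam = beam_lambda \<alpha> K m"
    using R by (metis norm_minus_cancel)
qed

section \<open>Roots of a perturbed exponential equation\<close>

text \<open>
  Confines the solutions of the quasi-polynomial equation to a half plane: there \<open>X = exp (L m)\<close>.
\<close>

lemma norm_le_if_square_le:
  fixes X \<alpha> \<beta> :: complex
  assumes "X\<^sup>2 = \<alpha> + \<beta> * X" "norm \<beta> \<le> 1"
  shows "norm X \<le> norm \<alpha> + 1"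
proof (rule ccontr)
  assume "\<not> ?thesis"
  then have *: "norm X > norm \<alpha> + 1" "norm X \<ge> 1" using norm_ge_zero[of \<alpha>] by linarith+
  have "(norm \<alpha> + 1) * norm X < norm X * norm X"
    using * by (intro mult_strict_right_mono) linarith+
  also have "\<dots> = norm (\<alpha> + \<beta> * X)"
    using assms(1) by (metis norm_mult power2_eq_square)
  also have "\<dots> \<le> norm \<alpha> + norm \<beta> * norm X"
    by (metis norm_mult norm_triangle_ineq)
  also have "\<dots> \<le> norm \<alpha> + 1 * norm X"
    using assms(2) by (intro add_left_mono mult_right_mono) auto
  finally have "norm \<alpha> * norm X < norm \<alpha>" by (simp add: algebra_simps)
  moreover have "norm \<alpha> * 1 \<le> norm \<alpha> * norm X"
    using * by (intro mult_left_mono) auto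
  ultimately show False by simp
qed

text \<open>
  By the Cauchy estimate a holomorphic function bounded by \<open>1/4\<close> on the disc of radius \<open>2\<close> has derivative at most
  \<open>1/2\<close> on the disc of radius \<open>1\<close>, so that \<open>w \<mapsto> c + \<eta> w\<close> is a contraction of the latter.
\<close>

lemma small_perturbation_unique_fixpoint:
  fixes \<eta> :: "complex \<Rightarrow> complex"
  assumes holo: "\<eta> holomorphic_on S" and S: "cball c 2 \<subseteq> S" "open S"
    and small: "\<And>w. w \<in> cball c 2 \<Longrightarrow> norm (\<eta> w) \<le> 1 / 4"
  shows "\<exists>!w. w \<in> cball c 1 \<and> c + \<eta> w = w"
proof -
  have sub: "cball w 1 \<subseteq> cball c 2" if "w \<in> cball c 1" for w
  proof
    fix v assume "v \<in> cball w 1"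
    then show "v \<in> cball c 2" using that dist_triangle[of c v w] by simp
  qed
  have hol: "\<eta> holomorphic_on cball c 2" using holo S(1) holomorphic_on_subset by blast
  have d: "(\<eta> has_field_derivative deriv \<eta> w) (at w within cball c 1)" if "w \<in> cball c 1" for w
  proof -
    have "w \<in> cball c 2" using that by simp
    then have "w \<in> S" using S(1) by blast
    then show ?thesis using holomorphic_derivI[OF holo S(2)] has_field_derivative_at_within by blast
  qed
  have bound: "norm (deriv \<eta> w) \<le> 1 / 2" if w: "w \<in> cball c 1" for w
  proof -
    have "norm ((deriv ^^ 1) \<eta> w) \<le> fact 1 * (1 / 2) / 1 ^ 1"
    proof (rule Cauchy_higher_deriv_bound)
      show "\<eta> holomorphic_on ball w 1"
        using sub[OF w] hol ball_subset_cball holomorphic_on_subset by blast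
      show "continuous_on (cball w 1) \<eta>"
        using sub[OF w] hol holomorphic_on_imp_continuous_on continuous_on_subset by blast
      show "\<eta> v \<in> ball 0 (1 / 2)" if "v \<in> ball w 1" for v
      proof -
        have "v \<in> cball w 1" using that by simp
        then have "v \<in> cball c 2" using sub[OF w] by blast
        from small[OF this] show ?thesis by simp
      qed
    qed auto
    then show ?thesis by simp
  qed
  have "\<exists>!w\<in>cball c 1. c + \<eta> w = w"
  proof (rule Banach_fix[of "cball c 1" "1 / 2"])
    show "(\<lambda>w. c + \<eta> w) ` cball c 1 \<subseteq> cball c 1"
    proof (rule image_subsetI)
      fix w assume "w \<in> cball c 1"
      then have "w \<in> cball c 2" by simp
      from small[OF this] show "c + \<eta> w \<in> cball c 1" by (simp add: dist_norm)
    qed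
    show "dist (c + \<eta> v) (c + \<eta> w) \<le> 1 / 2 * dist v w" if "v \<in> cball c 1" "w \<in> cball c 1" for v w
      using field_differentiable_bound[OF convex_cball d bound that] by (simp add: dist_norm)
  qed (auto simp: complete_eq_closed)
  then show ?thesis by blast
qed

text \<open>
  If \<open>exp (L m)\<close> is bounded, the equation reads \<open>exp (2 L m) = \<rho> (1 + \<epsilon> m)\<close> with \<open>\<rho> = a 0\<close> and \<open>\<epsilon> m = O(1 / m)\<close>.
  Taking logarithms makes it a family of fixed point equations \<open>m = c n + \<eta> m\<close>, one for each integer \<open>n\<close>, with
  \<open>\<eta> m = ln (1 + \<epsilon> m) / (2 L) = O(1 / m)\<close>. For large \<open>n\<close> such an equation has exactly one solution near \<open>c n\<close>, at distance
  \<open>\<eta> = O(1 / n)\<close>. Conversely a solution of large modulus has \<open>exp (L m)\<close> bounded and satisfies one of these equations,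
  whence it is the solution near \<open>c n\<close> for that \<open>n\<close>.
\<close>

lemma quasi_polynomial_roots:
  fixes L :: real and a b :: "complex \<Rightarrow> complex"
  assumes L: "L > 0" and a: "a analytic_on {0}" "a 0 \<noteq> 0" and b: "b analytic_on {0}" "b 0 = 0"
  defines "c \<equiv> \<lambda>n::int. (Ln (a 0) + of_int (2 * n) * pi * \<i>) / (2 * of_real L)"
  defines "E \<equiv> \<lambda>m. exp (2 * of_real L * m) = a (1 / m) + b (1 / m) * exp (of_real L * m)"
  obtains \<mu> :: "int \<Rightarrow> complex" and N C :: real where
    "\<forall>n. \<bar>real_of_int n\<bar> \<ge> N \<longrightarrow> E (\<mu> n) \<and> norm (\<mu> n - c n) \<le> C / \<bar>real_of_int n\<bar>"
    "\<forall>M. eventually (\<lambda>m. E m \<longrightarrow> (\<exists>n. \<bar>real_of_int n\<bar> \<ge> M \<and> m = \<mu> n)) at_infinity"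
proof -
  define \<rho> where "\<rho> = a 0"
  have \<rho>: "\<rho> \<noteq> 0" using a by (simp add: \<rho>_def)
  have c_eq: "c n = c 0 + of_int n * (of_real (pi / L) * \<i>)" for n
    using L by (simp add: c_def field_simps)
  have Re_c: "Re (c n) = Re (c 0)" for n by (subst c_eq) simp
  have c_dist: "norm (c n - c 0) = \<bar>real_of_int n\<bar> * pi / L" for n
    using L by (subst c_eq) (simp add: norm_mult norm_divide)
  obtain r1 where r1: "r1 > 0" "a holomorphic_on ball 0 r1" using a(1) by (auto simp: analytic_on_def)
  obtain r2 where r2: "r2 > 0" "b holomorphic_on ball 0 r2" using b(1) by (auto simp: analytic_on_def)
  define r where "r = min r1 r2"
  have r: "r > 0" "a holomorphic_on ball 0 r" "b holomorphic_on ball 0 r"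
    using r1 r2 by (auto simp: r_def elim: holomorphic_on_subset)
  obtain Ca where Ca: "Ca > 0" "eventually (\<lambda>\<zeta>. norm (a \<zeta> - a 0) \<le> Ca * norm \<zeta>) (nhds 0)"
    using analytic_eventually_lipschitz_at_0[OF a(1)] by blast
  obtain Cb where Cb: "Cb > 0" "eventually (\<lambda>\<zeta>. norm (b \<zeta> - b 0) \<le> Cb * norm \<zeta>) (nhds 0)"
    using analytic_eventually_lipschitz_at_0[OF b(1)] by blast
  define C1 where "C1 = max Ca Cb"
  obtain R0 where R0: "\<And>m. norm m \<ge> R0 \<Longrightarrow> norm (a (1 / m) - \<rho>) \<le> C1 / norm m"
      "\<And>m. norm m \<ge> R0 \<Longrightarrow> norm (b (1 / m)) \<le> C1 / norm m"
  proof -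
    from eventually_at_infinity_inverse[OF eventually_conj[OF Ca(2) Cb(2)]]
    obtain R where R: "\<And>m. norm m \<ge> R \<Longrightarrow> norm (a (1 / m) - \<rho>) \<le> Ca / norm m \<and> norm (b (1 / m)) \<le> Cb / norm m"
      unfolding eventually_at_infinity \<rho>_def b(2) by (auto simp: norm_divide)
    show ?thesis
    proof (rule that)
      fix m :: complex assume "norm m \<ge> R"
      moreover have "Ca / norm m \<le> C1 / norm m" "Cb / norm m \<le> C1 / norm m"
        by (auto simp: C1_def intro!: divide_right_mono)
      ultimately show "norm (a (1 / m) - \<rho>) \<le> C1 / norm m" "norm (b (1 / m)) \<le> C1 / norm m"
        using R[of m] by linarith+
    qed
  qed
  \<comment> \<open>The first bound holds for all large solutions of the equation, the second one on the discs of radius 2 about the c n.\<close>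
  define B where "B = max (norm \<rho> + 2) (exp (L * (Re (c 0) + 2)))"
  define C2 where "C2 = C1 * (2 + B) / norm \<rho>"
  have C1: "C1 > 0" using Ca by (simp add: C1_def less_max_iff_disj)
  have B: "B > 0" by (simp add: B_def less_max_iff_disj)
  have C2: "C2 > 0" using C1 B \<rho> by (simp add: C2_def)
  \<comment> \<open>Outside radius R1 the coefficient bounds apply, 1 / m lies in the disc where a and b are holomorphic, and the error stays below 1/2.\<close>
  define R1 where "R1 = Max {R0, C1, 2 * C2, 1 / r, 1}"
  have R1: "R1 \<ge> R0" "R1 \<ge> C1" "R1 \<ge> 2 * C2" "R1 \<ge> 1 / r" "R1 \<ge> 1" by (simp_all add: R1_def)
  define S where "S = {m::complex. R1 < norm m} \<inter> {m. norm (exp (of_real L * m)) < B + 1}"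
  have S_open: "open S"
    unfolding S_def by (intro open_Int open_Collect_less continuous_intros)
  define \<epsilon> where "\<epsilon> = (\<lambda>m. (a (1 / m) - \<rho> + b (1 / m) * exp (of_real L * m)) / \<rho>)"
  have \<epsilon>_le: "norm (\<epsilon> m) \<le> C2 / norm m" and \<epsilon>_small: "norm (\<epsilon> m) < 1 / 2" if m: "m \<in> S" for m
  proof -
    have mR: "norm m > R1" "norm (exp (of_real L * m)) \<le> B + 1" using m by (auto simp: S_def)
    then have m0: "norm m > 0" "R0 \<le> norm m" using R1 by linarith+
    have "norm (a (1 / m) - \<rho> + b (1 / m) * exp (of_real L * m))
        \<le> norm (a (1 / m) - \<rho>) + norm (b (1 / m)) * norm (exp (of_real L * m))"
      by (metis norm_mult norm_triangle_ineq)
    also have "\<dots> \<le> C1 / norm m + C1 / norm m * (B + 1)"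
      using R0[OF m0(2)] mR(2) C1 by (intro add_mono mult_mono) auto
    also have "\<dots> = C1 * (2 + B) / norm m" using m0 by (simp add: field_simps)
    finally have "norm (\<epsilon> m) \<le> C1 * (2 + B) / norm m / norm \<rho>"
      unfolding \<epsilon>_def norm_divide by (rule divide_right_mono) simp
    then show le: "norm (\<epsilon> m) \<le> C2 / norm m" by (simp add: C2_def field_simps)
    have "C2 / norm m < 1 / 2" using mR(1) R1(3) m0 by (simp add: field_simps)
    with le show "norm (\<epsilon> m) < 1 / 2" by linarith
  qed
  define \<eta> where "\<eta> = (\<lambda>m. Ln (1 + \<epsilon> m) / (2 * of_real L))"
  define C3 where "C3 = C2 / L"
  have C3: "C3 > 0" using C2 L by (simp add: C3_def)
  have \<eta>_le: "norm (\<eta> m) \<le> C3 / norm m" if "m \<in> S" for m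
  proof -
    have "norm (Ln (1 + \<epsilon> m)) \<le> 2 * (C2 / norm m)"
      using norm_Ln_le[OF \<epsilon>_small[OF that]] \<epsilon>_le[OF that] by linarith
    then have "norm (Ln (1 + \<epsilon> m)) / (2 * L) \<le> 2 * (C2 / norm m) / (2 * L)"
      using L by (intro divide_right_mono) auto
    then show ?thesis using L by (simp add: \<eta>_def C3_def norm_divide norm_mult mult.commute)
  qed
  have \<epsilon>_holo: "\<epsilon> holomorphic_on S"
  proof -
    have inv: "(\<lambda>m. 1 / m) holomorphic_on S" using R1(5) by (intro holomorphic_intros) (auto simp: S_def)
    have sub: "(\<lambda>m. 1 / m) ` S \<subseteq> ball 0 r"
    proof (rule image_subsetI)
      fix m assume "m \<in> S"
      then have "1 / r < norm m" "norm m > 0" using R1 by (auto simp: S_def)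
      then show "1 / m \<in> ball 0 r" using r(1) by (simp add: norm_divide field_simps)
    qed
    from holomorphic_on_compose_gen[OF inv r(2) sub] holomorphic_on_compose_gen[OF inv r(3) sub]
    show ?thesis unfolding \<epsilon>_def o_def by (intro holomorphic_intros) (auto simp: \<rho>)
  qed
  have ln_arg: "1 + \<epsilon> m \<notin> \<real>\<^sub>\<le>\<^sub>0" if "m \<in> S" for m
  proof -
    have "Re (\<epsilon> m) > - 1" using \<epsilon>_small[OF that] abs_Re_le_cmod[of "\<epsilon> m"] by linarith
    then show ?thesis by (auto simp: complex_nonpos_Reals_iff)
  qed
  have \<eta>_holo: "\<eta> holomorphic_on S"
    unfolding \<eta>_def using L ln_arg by (intro holomorphic_intros \<epsilon>_holo) auto
  have E_iff: "E m \<longleftrightarrow> (\<exists>n. c n + \<eta> m = m)" if "m \<in> S" for m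
  proof -
    have "1 + \<epsilon> m \<noteq> 0" using ln_arg[OF that] by auto
    then have "exp (Ln \<rho> + Ln (1 + \<epsilon> m)) = \<rho> * (1 + \<epsilon> m)" using \<rho> by (simp add: exp_add)
    also have "\<dots> = a (1 / m) + b (1 / m) * exp (of_real L * m)"
    proof -
      have "\<rho> * \<epsilon> m = a (1 / m) - \<rho> + b (1 / m) * exp (of_real L * m)" using \<rho> by (simp add: \<epsilon>_def)
      then show ?thesis by (simp add: distrib_left)
    qed
    finally have "E m \<longleftrightarrow> exp (2 * of_real L * m) = exp (Ln \<rho> + Ln (1 + \<epsilon> m))" by (simp add: E_def)
    also have "\<dots> \<longleftrightarrow> (\<exists>n. c n + \<eta> m = m)"
      unfolding exp_eq using L by (auto simp: c_def \<eta>_def \<rho>_def field_simps intro!: ex_cong1)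
    finally show ?thesis .
  qed
  \<comment> \<open>Far enough out for the discs of radius 2 to lie in S and for the perturbation to be at most 1/4 on them.\<close>
  define R2 where "R2 = Max {R1 + 3, 2 + 4 * C3}"
  have R2: "R2 \<ge> R1 + 3" "R2 \<ge> 2 + 4 * C3" by (simp_all add: R2_def)
  have ball_S: "cball (c n) 2 \<subseteq> S" and ball_norm: "\<And>w. w \<in> cball (c n) 2 \<Longrightarrow> norm w \<ge> norm (c n) - 2"
    if n: "norm (c n) \<ge> R2" for n
  proof -
    show nw: "norm w \<ge> norm (c n) - 2" if "w \<in> cball (c n) 2" for w
      using that norm_triangle_ineq2[of "c n" w] by (simp add: dist_norm)
    show "cball (c n) 2 \<subseteq> S"
    proof
      fix w assume w: "w \<in> cball (c n) 2"
      have "norm w > R1" using nw[OF w] n R2 by linarith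
      moreover have "Re w \<le> Re (c 0) + 2"
        using w abs_Re_le_cmod[of "c n - w"] by (simp add: dist_norm Re_c[of n])
      then have "norm (exp (of_real L * w)) \<le> B" using L by (simp add: B_def le_max_iff_disj)
      ultimately show "w \<in> S" by (simp add: S_def)
    qed
  qed
  have fixpoint: "\<exists>!w. w \<in> cball (c n) 1 \<and> c n + \<eta> w = w" if n: "norm (c n) \<ge> R2" for n
  proof (rule small_perturbation_unique_fixpoint[OF \<eta>_holo ball_S[OF n] S_open])
    fix w assume w: "w \<in> cball (c n) 2"
    have "norm w \<ge> 4 * C3" using ball_norm[OF n w] R2 n by linarith
    moreover from this have "norm w > 0" using C3 by linarith
    ultimately have "C3 / norm w \<le> 1 / 4" by (simp add: field_simps)
    moreover have "w \<in> S" using ball_S[OF n] w by blast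
    ultimately show "norm (\<eta> w) \<le> 1 / 4" using \<eta>_le[of w] by linarith
  qed
  define \<mu> where "\<mu> = (\<lambda>n. THE w. w \<in> cball (c n) 1 \<and> c n + \<eta> w = w)"
  have \<mu>: "\<mu> n \<in> cball (c n) 1" "c n + \<eta> (\<mu> n) = \<mu> n" if "norm (c n) \<ge> R2" for n
    using theI'[OF fixpoint[OF that]] by (auto simp: \<mu>_def)
  have \<mu>_eqI: "w = \<mu> n" if "norm (c n) \<ge> R2" "w \<in> cball (c n) 1" "c n + \<eta> w = w" for w n
    using fixpoint[OF that(1)] \<mu>[OF that(1)] that by blast
  \<comment> \<open>Consecutive centres are pi / L apart; half of this rate is kept after absorbing the constant terms.\<close>
  define N where "N = 2 * L / pi * (R2 + norm (c 0) + 1)"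
  have N_large: "norm (c n) \<ge> R2" "norm (\<mu> n) \<ge> \<bar>real_of_int n\<bar> * pi / (2 * L)" "n \<noteq> 0"
    if n: "\<bar>real_of_int n\<bar> \<ge> N" for n
  proof -
    define t where "t = \<bar>real_of_int n\<bar> * pi / (2 * L)"
    have t: "\<bar>real_of_int n\<bar> * pi / L = 2 * t" "t \<ge> 0" using L by (simp_all add: t_def)
    have *: "t \<ge> R2 + norm (c 0) + 1"
      using n L pi_gt_zero by (simp add: N_def t_def field_simps)
    have "norm (c n) \<ge> 2 * t - norm (c 0)"
      using c_dist[of n] norm_triangle_ineq4[of "c n" "c 0"] t(1) by linarith
    then have c_ge: "norm (c n) \<ge> t + R2 + 1" using * by linarith
    have R2_pos: "R2 > 0" using R2 R1(5) by linarith
    show c_R2: "norm (c n) \<ge> R2" using c_ge t(2) by linarith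
    have "norm (c n) - norm (\<mu> n) \<le> 1"
      using \<mu>(1)[OF c_R2] norm_triangle_ineq2[of "c n" "\<mu> n"] by (simp add: dist_norm)
    with c_ge R2_pos show "norm (\<mu> n) \<ge> \<bar>real_of_int n\<bar> * pi / (2 * L)"
      unfolding t_def[symmetric] by linarith
    have "R2 + norm (c 0) + 1 > 0" using R2_pos norm_ge_zero[of "c 0"] by linarith
    with * show "n \<noteq> 0" by (auto simp: t_def)
  qed
  show ?thesis
  proof (rule that[of N \<mu> "2 * L * C3 / pi"]; intro allI impI)
    fix n :: int assume n: "\<bar>real_of_int n\<bar> \<ge> N"
    note large = N_large[OF n]
    have inS: "\<mu> n \<in> S" using ball_S[OF large(1)] \<mu>(1)[OF large(1)] by auto
    have "E (\<mu> n)" using E_iff[OF inS] \<mu>(2)[OF large(1)] by blast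
    have \<mu>_dist: "norm (\<mu> n - c n) = norm (\<eta> (\<mu> n))"
      using \<mu>(2)[OF large(1)] by (metis add_diff_cancel_left')
    have "norm (\<mu> n - c n) \<le> C3 / norm (\<mu> n)"
      using \<eta>_le[OF inS] \<mu>_dist by simp
    also have "\<dots> \<le> C3 / (\<bar>real_of_int n\<bar> * pi / (2 * L))"
    proof -
      have "\<bar>real_of_int n\<bar> * pi / (2 * L) > 0" using large(3) L by simp
      moreover from this have "norm (\<mu> n) > 0" using large(2) by linarith
      ultimately show ?thesis using large(2) C3 by (intro divide_left_mono mult_pos_pos) auto
    qed
    also have "\<dots> = 2 * L * C3 / pi / \<bar>real_of_int n\<bar>" by (simp add: mult_ac)
    finally show "E (\<mu> n) \<and> norm (\<mu> n - c n) \<le> 2 * L * C3 / pi / \<bar>real_of_int n\<bar>"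
      using \<open>E (\<mu> n)\<close> by blast
  next
    fix M :: real
    define R3 where "R3 = Max {R1 + 1, C3, R2 + 1, norm (c 0) + M * pi / L + 1}"
    have R3: "R3 \<ge> R1 + 1" "R3 \<ge> C3" "R3 \<ge> R2 + 1" "R3 \<ge> norm (c 0) + M * pi / L + 1"
      by (simp_all add: R3_def)
    show "eventually (\<lambda>m. E m \<longrightarrow> (\<exists>n. \<bar>real_of_int n\<bar> \<ge> M \<and> m = \<mu> n)) at_infinity"
      unfolding eventually_at_infinity
    proof (intro exI[of _ R3] allI impI)
      fix m :: complex assume m: "norm m \<ge> R3" and Em: "E m"
      have m_pos: "norm m > 0" using m R3 R1 by linarith
      have m_R0: "norm m \<ge> R0" using m R3 R1 by linarith
      have "C1 / norm m \<le> 1" using m R3 R1 m_pos by (simp add: field_simps)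
      then have ab: "norm (a (1 / m)) \<le> norm \<rho> + 1" "norm (b (1 / m)) \<le> 1"
        using R0[OF m_R0] norm_triangle_ineq2[of "a (1 / m)" \<rho>] by linarith+
      have "(exp (of_real L * m))\<^sup>2 = a (1 / m) + b (1 / m) * exp (of_real L * m)"
        using Em by (simp add: E_def exp_double[symmetric] mult.assoc)
      from norm_le_if_square_le[OF this ab(2)] ab(1)
      have "norm (exp (of_real L * m)) \<le> norm \<rho> + 2" by linarith
      also have "\<dots> < B + 1" by (simp add: B_def)
      finally have mS: "m \<in> S" using m R3 by (simp add: S_def)
      then obtain n where n: "c n + \<eta> m = m" using E_iff Em by blast
      have "norm (c n - m) = norm (\<eta> m)" using n by (metis add_diff_cancel_left' norm_minus_commute)
      also have "\<dots> \<le> C3 / norm m" by (rule \<eta>_le[OF mS])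
      also have "\<dots> \<le> 1" using m R3 m_pos by (simp add: field_simps)
      finally have dist: "norm (c n - m) \<le> 1" .
      have "norm m - norm (c n) \<le> 1" using dist norm_triangle_ineq2[of m "c n"] by (simp add: norm_minus_commute)
      then have c_ge: "norm (c n) \<ge> R2" "norm (c n) \<ge> norm (c 0) + M * pi / L" using m R3 by linarith+
      have "m = \<mu> n" using \<mu>_eqI[OF c_ge(1) _ n] dist by (simp add: dist_norm)
      moreover have "M * pi / L \<le> \<bar>real_of_int n\<bar> * pi / L"
        using c_dist[of n] c_ge(2) norm_triangle_ineq2[of "c n" "c 0"] by linarith
      then have "M \<le> \<bar>real_of_int n\<bar>" using L by (simp add: divide_le_cancel)
      ultimately show "\<exists>n. \<bar>real_of_int n\<bar> \<ge> M \<and> m = \<mu> n" by blast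
    qed
  qed
qed

section \<open>Asymptotics of the eigenvalues\<close>

text \<open>
  The reflection coefficient \<open>x\<close> is real. Its principal logarithm has imaginary part \<open>0\<close> or \<open>pi\<close> according to its sign,
  which is the case distinction in \<open>rayleigh_sigma\<close>; its absolute value is the reciprocal of the one in
  \<open>rayleigh_sigma\<close>, whence the factor \<open>\<i>\<close> with \<open>\<i> \<i> = -1\<close>.
\<close>

lemma quasi_polynomial_centre_eq_sigma:
  assumes L: "L > 0" and \<alpha>: "\<alpha> > 0" and K: "K > 0" and \<gamma>: "\<gamma> > 0" "\<gamma> \<noteq> sqrt (\<alpha> / K)"
  defines "x \<equiv> (\<gamma> * sqrt (K / \<alpha>) - 1) / (\<gamma> * sqrt (K / \<alpha>) + 1)"
  shows "x \<noteq> 0"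
    and "(Ln (of_real x) + of_int (2 * int n) * pi * \<i>) / (2 * of_real L) = \<i> * rayleigh_sigma L \<alpha> K \<gamma> n"
proof -
  define g where "g = \<gamma> * sqrt (K / \<alpha>)"
  have inv: "sqrt (\<alpha> / K) = 1 / sqrt (K / \<alpha>)" by (simp add: real_sqrt_divide)
  have pos: "sqrt (K / \<alpha>) > 0" using K \<alpha> by simp
  have "g > 0" using \<gamma> pos by (simp add: g_def)
  moreover have "g \<noteq> 1"
    using \<gamma>(2) pos unfolding g_def inv by (metis less_irrefl nonzero_eq_divide_eq)
  moreover have "\<gamma> > sqrt (\<alpha> / K) \<longleftrightarrow> g > 1"
    unfolding g_def inv using pos by (rule pos_divide_less_eq)
  ultimately have g: "g > 0" "g \<noteq> 1" "\<gamma> > sqrt (\<alpha> / K) \<longleftrightarrow> g > 1" by auto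
  have x: "x = (g - 1) / (g + 1)" by (simp add: x_def g_def)
  show x0: "x \<noteq> 0" using g by (simp add: x)
  have "\<bar>x\<bar> = inverse \<bar>(g + 1) / (g - 1)\<bar>" using g by (simp add: x)
  then have ln_x: "ln \<bar>x\<bar> = - ln \<bar>(g + 1) / (g - 1)\<bar>"
    using g by (simp only: ln_inverse)
  have neg: "x < 0 \<longleftrightarrow> \<not> \<gamma> > sqrt (\<alpha> / K)"
    unfolding g(3) using g(1,2) by (auto simp: x divide_less_0_iff)
  show "(Ln (of_real x) + of_int (2 * int n) * pi * \<i>) / (2 * of_real L) = \<i> * rayleigh_sigma L \<alpha> K \<gamma> n"
  proof -
    define l where "l = ln \<bar>(g + 1) / (g - 1)\<bar>"
    have LL: "2 * complex_of_real L = of_real (2 * L)" by simp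
    have "(- of_real l + of_real \<theta> * \<i> + of_int (2 * int n) * pi * \<i>) / (2 * of_real L)
        = \<i> * (\<i> / of_real (2 * L) * of_real l + of_real (\<theta> / (2 * L) + real n * pi / L))" for \<theta> :: real
      unfolding LL using L by (simp add: complex_eq_iff add_divide_distrib)
    moreover have "pi / (2 * L) + real n * pi / L = (real n + 1 / 2) * pi / L"
      using L by (simp add: field_simps)
    ultimately show ?thesis
      unfolding Ln_of_real'[OF x0] ln_x neg rayleigh_sigma_def g_def[symmetric] l_def[symmetric]
      by (auto simp del: of_real_mult of_real_add of_real_divide)
  qed
qed

text \<open>
  The roots \<open>\<mu> n\<close> with \<open>n \<ge> N\<close> give the \<open>lamp n\<close>. The approximate eigenvalues \<open>s c n\<close> have imaginary parts in steps of
  \<open>s pi / L\<close>, and for large \<open>n\<close> the eigenvalues are within a quarter of a step of them. Hence they are distinct and lie in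
  the upper or lower half plane according to the sign of \<open>n\<close>. The eigenvalues in the lower half plane are not matched
  with negative \<open>n\<close> individually: they are reached by conjugating those in the upper one.
\<close>

theorem theorem3p3:
  fixes L \<alpha> K \<gamma>\<^sub>0 :: real
  assumes "L > 0" "\<alpha> > 0" "K > 0" "\<gamma>\<^sub>0 > 0" "\<gamma>\<^sub>0 \<noteq> sqrt (\<alpha> / K)"
  shows "\<exists>(lamp :: nat \<Rightarrow> complex) (lamm :: nat \<Rightarrow> complex) (N :: nat).
      (\<forall>n\<ge>N. lamm n = cnj (lamp n) \<and> Im (lamp n) > 0) \<and>
      inj_on lamp {N..} \<and>
      lamp ` {N..} \<union> lamm ` {N..} \<subseteq> rayleigh_eigenvalues L \<alpha> K \<gamma>\<^sub>0 \<and>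
      finite (rayleigh_eigenvalues L \<alpha> K \<gamma>\<^sub>0 - (lamp ` {N..} \<union> lamm ` {N..})) \<and>
      (\<lambda>n. lamp n - \<i> * of_real (sqrt (K / \<alpha>)) * rayleigh_sigma L \<alpha> K \<gamma>\<^sub>0 n)
        \<in> O(\<lambda>n. 1 / of_nat n)"
proof -
  let ?ev = "rayleigh_eigenvalues L \<alpha> K \<gamma>\<^sub>0"
  define s where "s = sqrt (K / \<alpha>)"
  have s: "s > 0" using assms by (simp add: s_def)
  define a b where "a = free_coeff L \<alpha> K \<gamma>\<^sub>0" and "b = exp_coeff L \<alpha> K \<gamma>\<^sub>0"
  define x where "x = (\<gamma>\<^sub>0 * sqrt (K / \<alpha>) - 1) / (\<gamma>\<^sub>0 * sqrt (K / \<alpha>) + 1)"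
  note ab = quasi_polynomial_coeffs(2-5)[OF assms(1-4), folded a_def b_def x_def]
  note x = quasi_polynomial_centre_eq_sigma[OF assms, folded x_def]
  define c where "c = (\<lambda>n::int. (Ln (a 0) + of_int (2 * n) * pi * \<i>) / (2 * of_real L))"
  define E where "E = (\<lambda>m. exp (2 * of_real L * m) = a (1 / m) + b (1 / m) * exp (of_real L * m))"
  have c_sigma: "of_real s * c (int n) = \<i> * of_real s * rayleigh_sigma L \<alpha> K \<gamma>\<^sub>0 n" for n
    unfolding c_def ab(4) x(2) by simp
  have a0: "a 0 \<noteq> 0" using x(1) ab(4) by simp
  obtain \<mu> :: "int \<Rightarrow> complex" and N1 C1 :: real where
    \<mu>: "\<forall>n. \<bar>real_of_int n\<bar> \<ge> N1 \<longrightarrow> E (\<mu> n) \<and> norm (\<mu> n - c n) \<le> C1 / \<bar>real_of_int n\<bar>"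
    and all: "\<forall>M. eventually (\<lambda>m. E m \<longrightarrow> (\<exists>n. \<bar>real_of_int n\<bar> \<ge> M \<and> m = \<mu> n)) at_infinity"
    unfolding c_def E_def by (rule quasi_polynomial_roots[OF assms(1) ab(1) a0 ab(2,3)])
  obtain C2 where C2: "C2 > 0"
    and asymp: "eventually (\<lambda>m. norm (beam_lambda \<alpha> K m - of_real s * m) \<le> C2 / norm m) at_infinity"
    using beam_lambda_asymp[OF assms(2,3)] unfolding s_def by blast
  have "eventually (\<lambda>m. beam_lambda \<alpha> K m \<in> ?ev \<longleftrightarrow> E m) at_infinity"
    using eigenvalue_iff_quasi_polynomial[OF assms(1-4)] by (simp add: E_def a_def b_def)
  from eventually_conj[OF asymp this]
  obtain R1 where R1: "\<And>m. norm m \<ge> R1 \<Longrightarrow> norm (beam_lambda \<alpha> K m - of_real s * m) \<le> C2 / norm m"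
      "\<And>m. norm m \<ge> R1 \<Longrightarrow> beam_lambda \<alpha> K m \<in> ?ev \<longleftrightarrow> E m"
    unfolding eventually_at_infinity by blast
  define \<Lambda> where "\<Lambda> = (\<lambda>n. beam_lambda \<alpha> K (\<mu> n))"
  have Im_c: "Im (c n) = (Im (Ln (a 0)) + 2 * of_int n * pi) / (2 * L)" for n
    by (simp add: c_def)
  have arg: "- pi < Im (Ln (a 0))" "Im (Ln (a 0)) \<le> pi"
    using a0 by (auto simp: mpi_less_Im_Ln Im_Ln_le_pi)
  define C3 where "C3 = C2 * (4 * L / pi) + s * \<bar>C1\<bar>"
  \<comment> \<open>Beyond N the modulus of the root is at least n pi / (4 L), and the eigenvalue is within s pi / (4 L) of its approximation.\<close>
  obtain N :: nat where "real N \<ge> Max {N1, 1, 4 * L / pi * \<bar>C1\<bar>, 4 * L / pi * R1, C3 * (4 * L / (s * pi))}"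
    using real_arch_simple by blast
  then have N: "real N \<ge> N1" "real N \<ge> 1" "real N \<ge> 4 * L / pi * \<bar>C1\<bar>"
      "real N \<ge> 4 * L / pi * R1" "real N \<ge> C3 * (4 * L / (s * pi))"
    by simp_all
  have \<Lambda>: "\<Lambda> n \<in> ?ev" "norm (\<Lambda> n - of_real s * c n) \<le> C3 / \<bar>real_of_int n\<bar>"
    "norm (\<Lambda> n - of_real s * c n) \<le> s * pi / (4 * L)" if n: "\<bar>real_of_int n\<bar> \<ge> real N" for n
  proof -
    define k where "k = \<bar>real_of_int n\<bar>"
    have k: "k \<ge> N1" "k \<ge> 1" using n N(1,2) by (simp_all add: k_def)
    have "4 * L / pi * \<bar>C1\<bar> \<le> k" "4 * L / pi * R1 \<le> k" using n N(3,4) by (simp_all add: k_def)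
    then have kR: "\<bar>C1\<bar> \<le> k * pi / (4 * L)" "R1 \<le> k * pi / (4 * L)"
      using assms(1) pi_gt_zero by (simp_all add: field_simps)
    have \<mu>n: "E (\<mu> n)" "norm (\<mu> n - c n) \<le> C1 / k" using \<mu>[rule_format, of n] k(1) by (simp_all add: k_def)
    have "\<bar>Im (Ln (a 0)) + 2 * real_of_int n * pi\<bar> \<ge> k * pi"
    proof -
      have "\<bar>2 * real_of_int n * pi\<bar> = 2 * (k * pi)" by (simp add: k_def abs_mult)
      moreover have "k * pi \<ge> pi" using k(2) by simp
      ultimately show ?thesis using arg by linarith
    qed
    then have "\<bar>Im (c n)\<bar> \<ge> k * pi / (2 * L)"
      unfolding Im_c using assms(1) by (simp add: divide_right_mono)
    then have "norm (c n) \<ge> k * pi / (2 * L)" using abs_Im_le_cmod order_trans by blast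
    moreover have "C1 / k \<le> \<bar>C1\<bar>"
      using k(2) mult_left_mono[of 1 k "\<bar>C1\<bar>"] by (simp add: divide_le_eq)
    moreover have "k * pi / (2 * L) = 2 * (k * pi / (4 * L))" by simp
    moreover have "norm (c n) - norm (\<mu> n - c n) \<le> norm (\<mu> n)"
      using norm_triangle_ineq2[of "c n" "c n - \<mu> n"] by (simp add: norm_minus_commute)
    ultimately have \<mu>_ge: "norm (\<mu> n) \<ge> k * pi / (4 * L)"
      using \<mu>n(2) kR(1) by linarith
    then have \<mu>_R1: "norm (\<mu> n) \<ge> R1" using kR(2) by linarith
    show "\<Lambda> n \<in> ?ev" using R1(2)[OF \<mu>_R1] \<mu>n(1) by (simp add: \<Lambda>_def)
    have "norm (\<Lambda> n - of_real s * \<mu> n) \<le> C2 / norm (\<mu> n)"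
      using R1(1)[OF \<mu>_R1] by (simp add: \<Lambda>_def)
    also have "\<dots> \<le> C2 / (k * pi / (4 * L))"
    proof -
      have "k * pi / (4 * L) > 0" using k(2) assms(1) by simp
      moreover from this have "norm (\<mu> n) > 0" using \<mu>_ge by linarith
      ultimately show ?thesis using \<mu>_ge C2 by (intro divide_left_mono mult_pos_pos) auto
    qed
    finally have 1: "norm (\<Lambda> n - of_real s * \<mu> n) \<le> C2 * (4 * L / pi) / k" by (simp add: field_simps)
    have "norm (of_real s * \<mu> n - of_real s * c n) = s * norm (\<mu> n - c n)"
      using s by (simp add: norm_mult flip: right_diff_distrib)
    also have "\<dots> \<le> s * (C1 / k)" using s \<mu>n(2) by (intro mult_left_mono) auto
    also have "\<dots> \<le> s * \<bar>C1\<bar> / k" using s k(2) by (simp add: divide_right_mono)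
    finally have 2: "norm (of_real s * \<mu> n - of_real s * c n) \<le> s * \<bar>C1\<bar> / k" .
    have "norm (\<Lambda> n - of_real s * c n)
        \<le> norm (\<Lambda> n - of_real s * \<mu> n) + norm (of_real s * \<mu> n - of_real s * c n)"
      using norm_triangle_ineq[of "\<Lambda> n - of_real s * \<mu> n" "of_real s * \<mu> n - of_real s * c n"] by simp
    with 1 2 have 3: "norm (\<Lambda> n - of_real s * c n) \<le> C3 / k"
      by (simp add: C3_def add_divide_distrib)
    then show "norm (\<Lambda> n - of_real s * c n) \<le> C3 / \<bar>real_of_int n\<bar>" by (simp add: k_def)
    have "C3 * (4 * L / (s * pi)) \<le> k" using N(5) n by (simp add: k_def)
    then have "C3 / k \<le> s * pi / (4 * L)" using k(2) s assms(1) by (simp add: field_simps)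
    with 3 show "norm (\<Lambda> n - of_real s * c n) \<le> s * pi / (4 * L)" by linarith
  qed
  note dist = \<Lambda>(3)
  have Im_pos: "Im (\<Lambda> n) > 0" if n: "n \<ge> int N" for n
  proof -
    have n1: "real_of_int n \<ge> 1" "\<bar>real_of_int n\<bar> \<ge> real N" using n N(2) by linarith+
    have "Im (c n) \<ge> pi / (2 * L)"
    proof -
      have "2 * real_of_int n * pi \<ge> 2 * pi" using n1 by simp
      then have "Im (Ln (a 0)) + 2 * of_int n * pi \<ge> pi" using arg by linarith
      then show ?thesis unfolding Im_c using assms(1) by (intro divide_right_mono) auto
    qed
    then have "s * Im (c n) \<ge> s * (pi / (2 * L))" using s by (intro mult_left_mono) auto
    moreover have "s * Im (c n) - Im (\<Lambda> n) \<le> s * pi / (4 * L)"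
      using dist[OF n1(2)] abs_Im_le_cmod[of "\<Lambda> n - of_real s * c n"] by simp
    moreover have "s * (pi / (2 * L)) - s * pi / (4 * L) > 0" using s assms(1) by (simp add: field_simps)
    ultimately show ?thesis by linarith
  qed
  have Im_neg: "Im (\<Lambda> n) < 0" if n: "n \<le> - int N" for n
  proof -
    have n1: "real_of_int n \<le> - 1" "\<bar>real_of_int n\<bar> \<ge> real N" using n N(2) by linarith+
    have "Im (c n) \<le> - (pi / (2 * L))"
    proof -
      have "2 * real_of_int n * pi \<le> 2 * (- 1) * pi" using n1 by (intro mult_right_mono) auto
      then have "Im (Ln (a 0)) + 2 * of_int n * pi \<le> - pi" using arg by linarith
      then have "(Im (Ln (a 0)) + 2 * of_int n * pi) / (2 * L) \<le> - pi / (2 * L)"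
        using assms(1) by (intro divide_right_mono) auto
      then show ?thesis by (simp add: Im_c)
    qed
    then have "s * Im (c n) \<le> s * (- (pi / (2 * L)))" using s by (intro mult_left_mono) auto
    moreover have "Im (\<Lambda> n) - s * Im (c n) \<le> s * pi / (4 * L)"
      using dist[OF n1(2)] abs_Im_le_cmod[of "\<Lambda> n - of_real s * c n"] by simp
    moreover have "s * (- (pi / (2 * L))) + s * pi / (4 * L) < 0" using s assms(1) by (simp add: field_simps)
    ultimately show ?thesis by linarith
  qed
  define lamp where "lamp = (\<lambda>n. \<Lambda> (int n))"
  define lamm where "lamm = (\<lambda>n. cnj (lamp n))"
  have inj: "inj_on lamp {N..}"
  proof (rule inj_onI, rule ccontr)
    fix i j assume ij: "i \<in> {N..}" "j \<in> {N..}" "lamp i = lamp j" "i \<noteq> j"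
    have "of_real s * c (int i) - of_real s * c (int j) = of_real (s * pi / L * (real i - real j)) * \<i>"
      using assms(1) by (simp add: c_def field_simps)
    then have "norm (of_real s * c (int i) - of_real s * c (int j)) = s * pi / L * \<bar>real i - real j\<bar>"
      using s assms(1) by (simp only: norm_mult norm_of_real norm_ii mult_1_right) (simp add: abs_mult)
    moreover have "s * pi / L * \<bar>real i - real j\<bar> \<ge> s * pi / L * 1"
      using s assms(1) ij(4) by (intro mult_left_mono) auto
    moreover have "norm (lamp i - of_real s * c (int i)) \<le> s * pi / (4 * L)"
        "norm (lamp j - of_real s * c (int j)) \<le> s * pi / (4 * L)"
      using dist[of "int i"] dist[of "int j"] ij by (simp_all add: lamp_def)
    moreover have "norm (of_real s * c (int i) - of_real s * c (int j))
        \<le> norm (lamp i - of_real s * c (int i)) + norm (lamp j - of_real s * c (int j))"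
      using norm_triangle_ineq4[of "lamp j - of_real s * c (int j)" "lamp i - of_real s * c (int i)"] ij(3) by simp
    moreover have "s * pi / (4 * L) + s * pi / (4 * L) < s * pi / L * 1"
      using s assms(1) by (simp add: field_simps)
    ultimately show False by linarith
  qed
  have sub: "lamp ` {N..} \<union> lamm ` {N..} \<subseteq> ?ev"
    using \<Lambda>(1) eigenvalues_cnj by (auto simp: lamp_def lamm_def)
  have fin: "finite (?ev - (lamp ` {N..} \<union> lamm ` {N..}))"
  proof -
    obtain R2 where R2: "\<And>m. norm m \<ge> R2 \<Longrightarrow> E m \<Longrightarrow> \<exists>n. \<bar>real_of_int n\<bar> \<ge> real N \<and> m = \<mu> n"
      using all[rule_format, of "real N"] unfolding eventually_at_infinity by blast
    obtain R where R: "\<forall>lam. norm lam \<ge> R \<longrightarrow> (\<exists>m. norm m \<ge> max R1 R2 \<and> lam = beam_lambda \<alpha> K m)"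
      by (rule beam_lambda_surj[OF assms(2,3)])
    have large: "\<exists>n. \<bar>n\<bar> \<ge> int N \<and> lam = \<Lambda> n" if lam: "lam \<in> ?ev" "norm lam \<ge> R" for lam
    proof -
      obtain m where m: "norm m \<ge> max R1 R2" "lam = beam_lambda \<alpha> K m" using R lam(2) by blast
      then have "E m" using R1(2) lam(1) by simp
      then obtain n where "\<bar>real_of_int n\<bar> \<ge> real N" "m = \<mu> n" using R2[of m] m(1) by auto
      then show ?thesis using m(2) by (intro exI[of _ n]) (auto simp: \<Lambda>_def)
    qed
    \<comment> \<open>A negative index would put the eigenvalue into the open lower half plane.\<close>
    have upper: "lam \<in> lamp ` {N..}" if lam: "lam \<in> ?ev" "norm lam \<ge> R" "Im lam \<ge> 0" for lam
    proof -
      obtain n where n: "\<bar>n\<bar> \<ge> int N" "lam = \<Lambda> n" using large[OF lam(1,2)] by blast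
      have "\<not> n \<le> - int N" using Im_neg[of n] n lam(3) by auto
      then have "n \<ge> int N" using n(1) by linarith
      then have "lam = lamp (nat n)" "nat n \<in> {N..}" using n(2) by (simp_all add: lamp_def)
      then show ?thesis by blast
    qed
    have "?ev - (lamp ` {N..} \<union> lamm ` {N..}) \<subseteq> ?ev \<inter> cball 0 R"
    proof
      fix lam assume lam: "lam \<in> ?ev - (lamp ` {N..} \<union> lamm ` {N..})"
      have "\<not> norm lam \<ge> R"
      proof
        assume R: "norm lam \<ge> R"
        show False
        proof (cases "Im lam \<ge> 0")
          case True
          then show False using upper[of lam] lam R by blast
        next
          case False
          then have "cnj lam \<in> lamp ` {N..}"
            using upper[of "cnj lam"] eigenvalues_cnj lam R by simp
          then obtain n where n: "n \<in> {N..}" "cnj lam = lamp n" by blast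
          have "lam = lamm n" using arg_cong[OF n(2), of cnj] by (simp add: lamm_def)
          with n(1) have "lam \<in> lamm ` {N..}" by blast
          then show False using lam by blast
        qed
      qed
      then show "lam \<in> ?ev \<inter> cball 0 R" using lam by simp
    qed
    then show ?thesis using finite_eigenvalues_in_disc[OF assms(1,3)] finite_subset by blast
  qed
  have "(\<lambda>n. lamp n - \<i> * of_real (sqrt (K / \<alpha>)) * rayleigh_sigma L \<alpha> K \<gamma>\<^sub>0 n) \<in> O(\<lambda>n. 1 / of_nat n)"
  proof (rule bigoI)
    show "eventually (\<lambda>n. norm (lamp n - \<i> * of_real (sqrt (K / \<alpha>)) * rayleigh_sigma L \<alpha> K \<gamma>\<^sub>0 n)
        \<le> C3 * norm (1 / of_nat n :: complex)) sequentially"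
      using eventually_ge_at_top[of N]
    proof eventually_elim
      case (elim n)
      then have "norm (\<Lambda> (int n) - of_real s * c (int n)) \<le> C3 / real n" using \<Lambda>(2)[of "int n"] by simp
      then show ?case unfolding c_sigma by (simp add: lamp_def s_def norm_divide)
    qed
  qed
  then show ?thesis
    using inj sub fin Im_pos
    by (intro exI[of _ lamp] exI[of _ lamm] exI[of _ N]) (auto simp: lamm_def lamp_def)
qed

end
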